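(* Let $d\ge6$. Then there exists a degree $d$ surface in $\mathbb{P}^3$ belonging to $\left(\overline{F(2,2;3)}\setminus F(2,2;3)\right)\cap F(1,4;3)$.
   Context: Work over $\mathbb{C}$. For positive integers $i_1,\dots,i_k<d$, $F(i_1,\dots,i_k;n)\subseteq|\mathcal{O}_{\mathbb{P}^n}(d)|$ is the set of degree $d$ hypersurfaces $\{f=0\}$ of $\mathbb{P}^n$ whose equation can be written $f=\sum_{h=1}^k f_hg_h$ with $f_h,g_h$ homogeneous, $\deg f_h=i_h$, $\deg g_h=d-i_h$, and $f_1,\dots,f_k$ a regular sequence (i.e. $\{f_1=\cdots=f_k=0\}$ is a complete intersection of dimension $n-k$). $\overline{F(i_1,\dots,i_k;n)}$ denotes the Zariski closure in $|\mathcal{O}_{\mathbb{P}^n}(d)|$. *)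

theory Defs
  imports Complex_Main "HOL-Library.Poly_Mapping"
begin

text \<open>Polynomials over the complex numbers in the variables x_0, x_1, ... (indexed by nat).
  A monomial is an exponent vector (nat =>0 nat); a polynomial is a finitely supported
  map from monomials to coefficients; multiplication is convolution (Poly_Mapping).\<close>

type_synonym mpoly = "(nat \<Rightarrow>\<^sub>0 nat) \<Rightarrow>\<^sub>0 complex"

definition mon_deg :: "(nat \<Rightarrow>\<^sub>0 nat) \<Rightarrow> nat" where
  "mon_deg m = (\<Sum>v\<in>Poly_Mapping.keys m. Poly_Mapping.lookup m v)"

text \<open>f is a homogeneous polynomial of degree d in the variables x_0,...,x_n
  (the zero polynomial counts as homogeneous of every degree).\<close>
definition hom_poly :: "nat \<Rightarrow> nat \<Rightarrow> mpoly \<Rightarrow> bool" where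
  "hom_poly n d f \<longleftrightarrow> (\<forall>m\<in>Poly_Mapping.keys f. Poly_Mapping.keys m \<subseteq> {..n} \<and> mon_deg m = d)"

definition in_ideal :: "mpoly list \<Rightarrow> mpoly \<Rightarrow> bool" where
  "in_ideal fs g \<longleftrightarrow> (\<exists>hs. length hs = length fs \<and> g = sum_list (map2 (*) hs fs))"

definition regular_seq :: "mpoly list \<Rightarrow> bool" where
  "regular_seq fs \<longleftrightarrow> \<not> in_ideal fs 1 \<and>
     (\<forall>i<length fs. \<forall>g. in_ideal (take i fs) (g * fs ! i) \<longrightarrow> in_ideal (take i fs) g)"

text \<open>Affine cone over F(i_1,...,i_k;n) in the space of degree d forms on P^n.\<close>
definition Fset :: "nat list \<Rightarrow> nat \<Rightarrow> nat \<Rightarrow> mpoly set" where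
  "Fset is n d = {f. \<exists>fs gs. length fs = length is \<and> length gs = length is \<and>
      (\<forall>h<length is. hom_poly n (is ! h) (fs ! h) \<and> hom_poly n (d - is ! h) (gs ! h)) \<and>
      regular_seq fs \<and> f = sum_list (map2 (*) fs gs)}"

text \<open>Polynomial functions on the coefficient space: a polynomial P whose variables are
  indexed by monomials, evaluated at the coefficient vector of f.\<close>
definition coeff_eval :: "(((nat \<Rightarrow>\<^sub>0 nat) \<Rightarrow>\<^sub>0 nat) \<Rightarrow>\<^sub>0 complex) \<Rightarrow> mpoly \<Rightarrow> complex" where
  "coeff_eval P f = (\<Sum>a\<in>Poly_Mapping.keys P. Poly_Mapping.lookup P a * (\<Prod>m\<in>Poly_Mapping.keys a. Poly_Mapping.lookup f m ^ Poly_Mapping.lookup a m))"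

definition zariski_closure :: "mpoly set \<Rightarrow> mpoly set" where
  "zariski_closure S = {f. \<forall>P. (\<forall>g\<in>S. coeff_eval P g = 0) \<longrightarrow> coeff_eval P f = 0}"

end

theory Submission
  imports Defs "HOL-Library.FuncSet" "HOL-Computational_Algebra.Fundamental_Theorem_Algebra"
begin

text \<open>
The surface is \<open>f = x\<^sub>0 A\<close>, the union of a plane and a general surface \<open>A = 0\<close> of degree \<open>d - 1\<close>
with \<open>A\<close> in the ideal \<open>(x\<^sub>0, x\<^sub>1, x\<^sub>2\<^sup>2)\<close>.  It lies in \<open>F(1,4)\<close> because it contains a plane.
It is a limit of members of \<open>F(2,2)\<close>: the quadrics \<open>q\<^sub>1 = x\<^sub>0\<^sup>2 - t\<^sup>2 x\<^sub>3\<^sup>2\<close> and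
\<open>q\<^sub>2 = x\<^sub>0 x\<^sub>1 + t x\<^sub>2\<^sup>2\<close> form a regular sequence for \<open>t \<noteq> 0\<close>, and
\<open>(x\<^sub>0 q\<^sub>2 - x\<^sub>1 q\<^sub>1) / t\<close> tends to \<open>x\<^sub>0 x\<^sub>2\<^sup>2\<close>, so that
\<open>x\<^sub>0 (x\<^sub>0, x\<^sub>1, x\<^sub>2\<^sup>2)\<close> is contained in the limit of the ideals \<open>(q\<^sub>1, q\<^sub>2)\<close>.

If \<open>x\<^sub>0 A\<close> belongs to the ideal of a complete intersection of two quadrics, remove from that
curve its components in the plane \<open>x\<^sub>0 = 0\<close>.  What is left lies on \<open>A = 0\<close> and is a plane conic,
a (possibly degenerate) twisted cubic, or the whole intersection of the two quadrics.  A count of parameters shows that the forms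
\<open>A\<close> vanishing on such a curve depend on fewer parameters than the ideal has dimensions in degree
\<open>d - 1 \<ge> 5\<close>, so a suitable \<open>A\<close> exists.
\<close>

subsection \<open>Polynomial images of lower dimension\<close>

text \<open>No curve is ever handled as a point set. The traces of the two quadrics on the plane
  \<open>x\<^sub>0 = 0\<close> span a (possibly degenerate) pencil of conics, and over the complex
  numbers such a pencil has a singular member; so one generator may be taken to restrict to a
  product \<open>l m\<close> of linear forms. Linear forms are prime, and this is enough to solve
  the relation that \<open>x\<^sub>0 A = p g + q h\<close> induces on the plane and then to cancel
  \<open>x\<^sub>0\<close>. The outcome is an explicit presentation of \<open>A\<close> of one of
  three shapes.

  Dimensions become numbers of coefficients: each shape is brought into a normal form whose
  remaining coefficients are the parameters of a polynomial map. With \<open>d = u + 5\<close>,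
  these numbers fall short of the number of monomials of degree \<open>u + 4\<close> by at least
  \<open>2 u + 1\<close> (conic), \<open>3 u\<close> (cubic) and \<open>4 u - 1\<close> (quartic).
  The ideal containing \<open>A\<close> has codimension 2 in that degree, so each of the three must
  exceed 2, which holds exactly for \<open>u \<ge> 1\<close>, that is
  \<open>d \<ge> 6\<close>.\<close>

lemma linear_system_nontrivial:
  fixes a :: "'s \<Rightarrow> 't \<Rightarrow> 'k::field"
  assumes "finite T" "finite S" "card T < card S"
  shows "\<exists>c. (\<exists>s\<in>S. c s \<noteq> 0) \<and> (\<forall>t\<in>T. (\<Sum>s\<in>S. c s * a s t) = 0)"
  using assms
proof (induction T arbitrary: S a rule: finite_induct)
  case empty
  then have "S \<noteq> {}" by auto
  then show ?case by (intro exI[of _ "\<lambda>_. 1"]) auto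
next
  case (insert t T)
  show ?case
  proof (cases "\<forall>s\<in>S. a s t = 0")
    case True
    from insert have "card T < card S" by simp
    from insert.IH[OF insert.prems(1) this, of a] True show ?thesis
      by auto
  next
    case False
    then obtain s0 where s0: "s0 \<in> S" "a s0 t \<noteq> 0" by auto
    let ?S = "S - {s0}"
    \<comment> \<open>Gaussian elimination with pivot row \<open>s0\<close>: \<open>a'\<close>
      vanishes in column \<open>t\<close>, and the pivot coefficient \<open>z\<close> below accounts
      for the subtracted multiples.\<close>
    define a' where "a' s u = a s u - a s t / a s0 t * a s0 u" for s u
    have "card T < card ?S" using insert s0 by simp
    with insert.IH[of ?S a'] insert.prems obtain c where c: "\<exists>s\<in>?S. c s \<noteq> 0"
      "\<And>u. u \<in> T \<Longrightarrow> (\<Sum>s\<in>?S. c s * a' s u) = 0" by auto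
    define z where "z = - (\<Sum>s\<in>?S. c s * (a s t / a s0 t))"
    let ?c = "c(s0 := z)"
    have *: "(\<Sum>s\<in>S. ?c s * a s u) = (\<Sum>s\<in>?S. c s * a' s u)" for u
    proof -
      have "(\<Sum>s\<in>S. ?c s * a s u) = z * a s0 u + (\<Sum>s\<in>?S. ?c s * a s u)"
        using s0 insert.prems by (simp add: sum.remove)
      also have "(\<Sum>s\<in>?S. ?c s * a s u) = (\<Sum>s\<in>?S. c s * a s u)"
        by (intro sum.cong) auto
      finally show ?thesis
        by (simp add: z_def a'_def sum_subtractf right_diff_distrib sum_distrib_right mult.assoc)
    qed
    have "(\<Sum>s\<in>S. ?c s * a s t) = 0"
      unfolding * using s0 by (simp add: a'_def)
    then have "\<forall>u\<in>insert t T. (\<Sum>s\<in>S. ?c s * a s u) = 0"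
      using c(2) * by auto
    moreover have "\<exists>s\<in>S. ?c s \<noteq> 0" using c(1) by auto
    ultimately show ?thesis by blast
  qed
qed

text \<open>The bound \<open>D\<close> is on the degree in each variable separately, so there are
  exactly \<open>(D + 1) ^ card I\<close> coefficients, the number that the counting argument
  needs.\<close>

definition poly_fun :: "'i set \<Rightarrow> nat \<Rightarrow> (('i \<Rightarrow> complex) \<Rightarrow> complex) \<Rightarrow> bool" where
  "poly_fun I D g \<longleftrightarrow> (\<exists>a. \<forall>x. g x = (\<Sum>\<tau>\<in>Pi\<^sub>E I (\<lambda>_. {..D}). a \<tau> * (\<Prod>i\<in>I. x i ^ \<tau> i)))"

section \<open>Closure properties of polynomial functions\<close>

lemma poly_fun_monomial:
  fixes I :: "'i set" and \<sigma> :: "'i \<Rightarrow> nat"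
  assumes I: "finite I" and \<sigma>: "\<And>i. i \<in> I \<Longrightarrow> \<sigma> i \<le> D"
  shows "poly_fun I D (\<lambda>x. c * (\<Prod>i\<in>I. x i ^ \<sigma> i))"
proof -
  let ?P = "Pi\<^sub>E I (\<lambda>_. {..D})"
  define s where "s = restrict \<sigma> I"
  define a where "a \<tau> = (if \<tau> = s then c else 0)" for \<tau>
  have P: "finite ?P" "s \<in> ?P"
    using I \<sigma> by (auto simp: s_def intro!: finite_PiE)
  have "c * (\<Prod>i\<in>I. x i ^ \<sigma> i) = (\<Sum>\<tau>\<in>?P. a \<tau> * (\<Prod>i\<in>I. x i ^ \<tau> i))" for x :: "'i \<Rightarrow> complex"
  proof -
    have "(\<Sum>\<tau>\<in>?P. a \<tau> * (\<Prod>i\<in>I. x i ^ \<tau> i)) = a s * (\<Prod>i\<in>I. x i ^ s i)"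
      using P by (subst sum.remove[OF P]) (auto simp: a_def intro!: sum.neutral)
    also have "(\<Prod>i\<in>I. x i ^ s i) = (\<Prod>i\<in>I. x i ^ \<sigma> i)"
      by (intro prod.cong) (auto simp: s_def)
    finally show ?thesis by (simp add: a_def)
  qed
  then show ?thesis unfolding poly_fun_def by (intro exI[of _ a] allI)
qed

lemma poly_fun_const: "finite I \<Longrightarrow> poly_fun I D (\<lambda>_. c)"
  using poly_fun_monomial[of I "\<lambda>_. 0" D c] by simp

lemma poly_fun_var:
  assumes "finite I" "i \<in> I" shows "poly_fun I 1 (\<lambda>x. x i)"
proof -
  have "(\<Prod>j\<in>I. x j ^ (if j = i then 1 else 0)) = x i" for x :: "'a \<Rightarrow> complex"
    using assms by (subst prod.remove[OF assms]) (auto intro!: prod.neutral)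
  then show ?thesis
    using poly_fun_monomial[of I "\<lambda>j. if j = i then 1 else 0" 1 1] assms by simp
qed

lemma poly_fun_mult:
  assumes "finite I" "poly_fun I D g" "poly_fun I E h"
  shows "poly_fun I (D + E) (\<lambda>x. g x * h x)"
proof -
  let ?P = "\<lambda>D::nat. Pi\<^sub>E I (\<lambda>_. {..D})"
  from assms obtain a b where
    a: "\<And>x. g x = (\<Sum>\<tau>\<in>?P D. a \<tau> * (\<Prod>i\<in>I. x i ^ \<tau> i))" and
    b: "\<And>x. h x = (\<Sum>\<tau>\<in>?P E. b \<tau> * (\<Prod>i\<in>I. x i ^ \<tau> i))"
    unfolding poly_fun_def by blast
  let ?r = "\<lambda>(\<tau>, \<sigma>). restrict (\<lambda>i. \<tau> i + \<sigma> i :: nat) I"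
  let ?S = "?P D \<times> ?P E"
  \<comment> \<open>Convolution of the coefficients; \<open>restrict\<close> keeps the sum of two
    exponent vectors extensional, so that it indexes a coefficient of the product.\<close>
  define c where "c \<rho> = (\<Sum>p\<in>{p\<in>?S. ?r p = \<rho>}. a (fst p) * b (snd p))" for \<rho>
  have fin: "finite (?P D)" for D using assms by (simp add: finite_PiE)
  have img: "?r ` ?S \<subseteq> ?P (D + E)"
  proof (rule image_subsetI, rule PiE_I)
    fix p i assume p: "p \<in> ?S" and i: "i \<in> I"
    have "fst p i \<in> {..D}" "snd p i \<in> {..E}"
      using p i PiE_mem[of "fst p" I _ i] PiE_mem[of "snd p" I _ i] unfolding mem_Times_iff by blast+
    then show "?r p i \<in> {..D + E}" using i by (simp add: case_prod_beta)
  next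
    fix p i assume "i \<notin> I"
    then show "?r p i = undefined" by (simp add: case_prod_beta)
  qed
  have "g x * h x = (\<Sum>\<rho>\<in>?P (D + E). c \<rho> * (\<Prod>i\<in>I. x i ^ \<rho> i))" for x
  proof -
    have "g x * h x = (\<Sum>p\<in>?S. a (fst p) * b (snd p) * (\<Prod>i\<in>I. x i ^ ?r p i))"
      unfolding a b sum_product sum.cartesian_product
    proof (rule sum.cong[OF refl])
      fix p assume "p \<in> ?S"
      have "(\<Prod>i\<in>I. x i ^ ?r p i) = (\<Prod>i\<in>I. x i ^ fst p i * x i ^ snd p i)"
        by (rule prod.cong) (simp_all add: case_prod_beta power_add)
      then show "(case p of (\<tau>, \<sigma>) \<Rightarrow> a \<tau> * (\<Prod>i\<in>I. x i ^ \<tau> i) * (b \<sigma> * (\<Prod>i\<in>I. x i ^ \<sigma> i))) =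
          a (fst p) * b (snd p) * (\<Prod>i\<in>I. x i ^ ?r p i)"
        by (simp add: case_prod_beta prod.distrib)
    qed
    also have "\<dots> = (\<Sum>\<rho>\<in>?P (D + E). \<Sum>p\<in>{p\<in>?S. ?r p = \<rho>}. a (fst p) * b (snd p) * (\<Prod>i\<in>I. x i ^ ?r p i))"
      by (rule sum.group[symmetric, OF finite_cartesian_product[OF fin fin] fin img])
    also have "\<dots> = (\<Sum>\<rho>\<in>?P (D + E). c \<rho> * (\<Prod>i\<in>I. x i ^ \<rho> i))"
      unfolding c_def sum_distrib_right
      by (intro sum.cong refl) (simp del: restrict_apply)
    finally show ?thesis .
  qed
  then show ?thesis unfolding poly_fun_def by (intro exI[of _ c] allI)
qed

lemma poly_fun_add:
  assumes "poly_fun I D g" "poly_fun I D h"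
  shows "poly_fun I D (\<lambda>x. g x + h x)"
proof -
  from assms obtain a b where
    "\<And>x. g x = (\<Sum>\<tau>\<in>Pi\<^sub>E I (\<lambda>_. {..D}). a \<tau> * (\<Prod>i\<in>I. x i ^ \<tau> i))"
    "\<And>x. h x = (\<Sum>\<tau>\<in>Pi\<^sub>E I (\<lambda>_. {..D}). b \<tau> * (\<Prod>i\<in>I. x i ^ \<tau> i))"
    unfolding poly_fun_def by blast
  then show ?thesis
    unfolding poly_fun_def
    by (intro exI[of _ "\<lambda>\<tau>. a \<tau> + b \<tau>"]) (simp add: sum.distrib distrib_right)
qed

lemma poly_fun_mono:
  assumes "finite I" "poly_fun I D g" "D \<le> E"
  shows "poly_fun I E g"
  using poly_fun_mult[OF assms(1,2) poly_fun_const[OF assms(1), of "E - D" 1]] assms(3) by simp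

lemma poly_fun_power:
  assumes "finite I" "poly_fun I D g"
  shows "poly_fun I (k * D) (\<lambda>x. g x ^ k)"
proof (induction k)
  case 0
  show ?case using poly_fun_const[OF assms(1)] by simp
next
  case (Suc k)
  then show ?case using poly_fun_mult[OF assms Suc] by simp
qed

lemma poly_fun_prod:
  assumes "finite I" "finite J" "\<And>j. j \<in> J \<Longrightarrow> poly_fun I D (g j)"
  shows "poly_fun I (card J * D) (\<lambda>x. \<Prod>j\<in>J. g j x)"
  using assms(2,3)
proof (induction J rule: finite_induct)
  case empty
  show ?case using poly_fun_const[OF assms(1)] by simp
next
  case (insert j J)
  then show ?case using poly_fun_mult[OF assms(1), of D "g j"] by simp
qed

definition is_poly_fun :: "'i set \<Rightarrow> (('i \<Rightarrow> complex) \<Rightarrow> complex) \<Rightarrow> bool" where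
  "is_poly_fun I g \<longleftrightarrow> (\<exists>D. poly_fun I D g)"

lemma is_poly_fun_const: "finite I \<Longrightarrow> is_poly_fun I (\<lambda>_. c)"
  unfolding is_poly_fun_def by (rule exI[of _ 0]) (rule poly_fun_const)

lemma is_poly_fun_var: "finite I \<Longrightarrow> i \<in> I \<Longrightarrow> is_poly_fun I (\<lambda>x. x i)"
  unfolding is_poly_fun_def by (rule exI[of _ 1]) (rule poly_fun_var)

lemma is_poly_fun_mult:
  "finite I \<Longrightarrow> is_poly_fun I g \<Longrightarrow> is_poly_fun I h \<Longrightarrow> is_poly_fun I (\<lambda>x. g x * h x)"
  unfolding is_poly_fun_def by (elim exE) (rule exI, rule poly_fun_mult)

lemma is_poly_fun_add:
  assumes "finite I" "is_poly_fun I g" "is_poly_fun I h"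
  shows "is_poly_fun I (\<lambda>x. g x + h x)"
proof -
  from assms obtain D E where "poly_fun I D g" "poly_fun I E h" unfolding is_poly_fun_def by blast
  then have "poly_fun I (max D E) g" "poly_fun I (max D E) h"
    using assms(1) by (auto intro: poly_fun_mono)
  then show ?thesis unfolding is_poly_fun_def by (intro exI[of _ "max D E"] poly_fun_add)
qed

lemma is_poly_fun_sum:
  assumes "finite I" "finite J" "\<And>j. j \<in> J \<Longrightarrow> is_poly_fun I (g j)"
  shows "is_poly_fun I (\<lambda>x. \<Sum>j\<in>J. g j x)"
  using assms(2,3)
proof (induction J rule: finite_induct)
  case empty
  show ?case by (simp add: is_poly_fun_const assms(1))
next
  case (insert j J)
  then have "is_poly_fun I (\<lambda>x. g j x + (\<Sum>j\<in>J. g j x))"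
    by (intro is_poly_fun_add assms(1)) simp_all
  then show ?case using insert(1,2) by simp
qed

text \<open>For \<open>s < K ^ N\<close> the base \<open>K\<close> digits recover \<open>s\<close>;
  hence the Kronecker substitution sends distinct monomials with exponents below \<open>K\<close> to
  distinct powers of \<open>z\<close>.\<close>

lemma sum_digits:
  fixes K :: nat
  shows "(\<Sum>i<N. (s div K ^ i mod K) * K ^ i) = s mod K ^ N"
proof (induction N)
  case (Suc N)
  have "s mod (K ^ N * K) = K ^ N * (s div K ^ N mod K) + s mod K ^ N"
    by (rule mod_mult2_eq)
  with Suc show ?case by (simp add: mult.commute)
qed simp

text \<open>A polynomial relation among the coordinates that holds on every image is found by
  comparing numbers of monomials; the Kronecker substitution \<open>y i = z ^ (K ^ i)\<close> turns it
  into a nonzero polynomial in one variable, so it cannot hold everywhere.\<close>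

lemma polynomial_images_not_covering:
  fixes \<phi> :: "'c \<Rightarrow> nat \<Rightarrow> ('i \<Rightarrow> complex) \<Rightarrow> complex"
  assumes C: "finite C" and I: "\<And>c. c \<in> C \<Longrightarrow> finite (I c)" "\<And>c. c \<in> C \<Longrightarrow> card (I c) < N"
    and \<phi>: "\<And>c i. c \<in> C \<Longrightarrow> i < N \<Longrightarrow> is_poly_fun (I c) (\<phi> c i)"
  shows "\<exists>y. \<forall>c\<in>C. \<forall>x. \<exists>i<N. \<phi> c i x \<noteq> y i"
proof (cases "C = {}")
  case True
  then show ?thesis by auto
next
  case False
  then have N: "N > 0" using I by force
  from \<phi> obtain Dg where Dg: "\<And>c i. c \<in> C \<Longrightarrow> i < N \<Longrightarrow> poly_fun (I c) (Dg c i) (\<phi> c i)"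
    unfolding is_poly_fun_def by metis
  define D where "D = (\<Sum>c\<in>C. \<Sum>i<N. Dg c i)"
  have Dle: "Dg c i \<le> D" if "c \<in> C" "i < N" for c i
  proof -
    have "Dg c i \<le> (\<Sum>i<N. Dg c i)" using that by (intro member_le_sum) auto
    also have "\<dots> \<le> D" unfolding D_def using that C by (intro member_le_sum) auto
    finally show ?thesis .
  qed
  \<comment> \<open>There are \<open>K ^ N\<close> monomials in the coordinates with exponents below
    \<open>K\<close>. Killing them on all images costs at most
    \<open>card C * (M + 1) ^ (N - 1)\<close> equations, and
    \<open>M + 1 \<le> (N * D + 1) * K\<close>. This \<open>K\<close> exceeds
    \<open>card C * (N * D + 1) ^ (N - 1)\<close> by one, so unknowns outnumber equations.\<close>
  define K where "K = card C * (N * D + 1) ^ (N - 1) + 1"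
  define M where "M = N * (K * D)"
  \<comment> \<open>The number \<open>s\<close> encodes the monomial whose exponents are its base
    \<open>K\<close> digits; \<open>G c s\<close> is that monomial evaluated at the coordinates of
    \<open>\<phi> c\<close>.\<close>
  define dg where "dg s i = s div K ^ i mod K" for s i
  define G where "G c s x = (\<Prod>i<N. \<phi> c i x ^ dg s i)" for c s x
  have K: "K > 0" by (simp add: K_def)
  have "poly_fun (I c) M (G c s)" if c: "c \<in> C" for c s
  proof -
    have "poly_fun (I c) (card {..<N} * (K * D)) (\<lambda>x. \<Prod>i\<in>{..<N}. \<phi> c i x ^ dg s i)"
    proof (rule poly_fun_prod)
      fix i assume "i \<in> {..<N}"
      then have "poly_fun (I c) D (\<phi> c i)" using Dle Dg c I(1) poly_fun_mono by (metis lessThan_iff)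
      then have "poly_fun (I c) (dg s i * D) (\<lambda>x. \<phi> c i x ^ dg s i)"
        using poly_fun_power I(1) c by blast
      moreover have "dg s i \<le> K" using K by (simp add: dg_def less_imp_le)
      ultimately show "poly_fun (I c) (K * D) (\<lambda>x. \<phi> c i x ^ dg s i)"
        using I(1) c by (auto intro: poly_fun_mono)
    qed (use I c in auto)
    then show ?thesis by (simp add: G_def[abs_def] M_def)
  qed
  then obtain a where a: "\<And>c s x. c \<in> C \<Longrightarrow>
      G c s x = (\<Sum>\<tau>\<in>Pi\<^sub>E (I c) (\<lambda>_. {..M}). a c s \<tau> * (\<Prod>i\<in>I c. x i ^ \<tau> i))"
    unfolding poly_fun_def by metis
  \<comment> \<open>One equation for each coefficient in each family, so that the same relation
    \<open>u\<close> holds on all the images at once.\<close>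
  let ?T = "Sigma C (\<lambda>c. Pi\<^sub>E (I c) (\<lambda>_. {..M}))"
  have finT: "finite ?T" using C I by (auto simp: finite_PiE)
  have "card ?T = (\<Sum>c\<in>C. (M + 1) ^ card (I c))"
    using C I by (subst card_SigmaI) (auto simp: finite_PiE card_PiE)
  also have "\<dots> \<le> (\<Sum>c\<in>C. (M + 1) ^ (N - 1))"
    using I N by (intro sum_mono power_increasing) (auto simp: Suc_leI less_Suc_eq_le[symmetric])
  also have "\<dots> \<le> card C * ((N * D + 1) * K) ^ (N - 1)"
  proof -
    have "M + 1 \<le> (N * D + 1) * K" using K by (simp add: M_def algebra_simps)
    then show ?thesis by (simp add: power_mono)
  qed
  also have "\<dots> < K * K ^ (N - 1)"
  proof -
    have "card C * ((N * D + 1) * K) ^ (N - 1) = (K - 1) * K ^ (N - 1)"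
      unfolding power_mult_distrib by (simp only: K_def mult.assoc diff_add_inverse2)
    also have "\<dots> < K * K ^ (N - 1)" using K by simp
    finally show ?thesis .
  qed
  also have "\<dots> = K ^ N" using N by (cases N) auto
  finally have "card ?T < card {..<K ^ N}" by simp
  from linear_system_nontrivial[OF finT finite_lessThan this, of "\<lambda>s (c, \<tau>). a c s \<tau>"]
  obtain u where u: "\<exists>s<K ^ N. u s \<noteq> 0"
    "\<And>c \<tau>. c \<in> C \<Longrightarrow> \<tau> \<in> Pi\<^sub>E (I c) (\<lambda>_. {..M}) \<Longrightarrow> (\<Sum>s<K ^ N. u s * a c s \<tau>) = 0"
    by auto
  have rel: "(\<Sum>s<K ^ N. u s * G c s x) = 0" if c: "c \<in> C" for c x
  proof -
    have "(\<Sum>s<K ^ N. u s * G c s x)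
      = (\<Sum>\<tau>\<in>Pi\<^sub>E (I c) (\<lambda>_. {..M}). \<Sum>s<K ^ N. u s * a c s \<tau> * (\<Prod>i\<in>I c. x i ^ \<tau> i))"
      using c by (subst sum.swap) (simp add: a sum_distrib_left mult.assoc)
    also have "\<dots> = 0"
      using u(2)[OF c] by (simp add: sum_distrib_right[symmetric])
    finally show ?thesis .
  qed
  define R where "R = (\<Sum>s<K ^ N. monom (u s) s)"
  have "coeff R s = u s" if "s < K ^ N" for s
    using that by (simp add: R_def coeff_sum)
  then have "R \<noteq> 0" using u(1) by auto
  then obtain z where z: "poly R z \<noteq> 0" using poly_all_0_iff_0 by blast
  have "\<exists>i<N. \<phi> c i x \<noteq> z ^ (K ^ i)" if c: "c \<in> C" for c x
  proof (rule ccontr)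
    assume "\<not> ?thesis"
    then have "G c s x = (\<Prod>i<N. z ^ (dg s i * K ^ i))" for s
      by (simp add: G_def power_mult[symmetric] mult.commute)
    then have "G c s x = z ^ s" if "s < K ^ N" for s
      using that by (simp add: power_sum[symmetric] dg_def sum_digits)
    with rel[OF c, of x] have "(\<Sum>s<K ^ N. u s * z ^ s) = 0" by simp
    with z show False by (simp add: R_def poly_sum poly_monom)
  qed
  then show ?thesis by (intro exI[of _ "\<lambda>i. z ^ (K ^ i)"]) blast
qed

subsection \<open>Polynomials\<close>

definition Var :: "nat \<Rightarrow> mpoly" where
  "Var i = Poly_Mapping.single (Poly_Mapping.single i 1) 1"

definition Const :: "complex \<Rightarrow> mpoly" where
  "Const c = Poly_Mapping.single 0 c"

lemma Const_simps [simp]: "Const 0 = 0" "Const 1 = 1"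
  by (simp_all add: Const_def)

lemma Const_add: "Const (a + b) = Const a + Const b"
  and Const_uminus: "Const (- a) = - Const a"
  and Const_mult: "Const (a * b) = Const a * Const b"
  by (simp_all add: Const_def single_add single_uminus mult_single)

lemma Const_inverse: "c \<noteq> 0 \<Longrightarrow> Const c * Const (inverse c) = 1"
  by (simp flip: Const_mult)

lemma lookup_Const_times [simp]:
  "Poly_Mapping.lookup (Const c * f) m = c * Poly_Mapping.lookup f m"
proof -
  have "Const c * f = Poly_Mapping.map ((*) c) f"
    by (simp add: Const_def mult_map_scale_conv_mult)
  then show ?thesis by (simp add: Poly_Mapping.map.rep_eq when_def)
qed

lemma sum_single_keys:
  fixes f :: "'a \<Rightarrow>\<^sub>0 'b::comm_monoid_add"
  shows "finite M \<Longrightarrow> Poly_Mapping.keys f \<subseteq> M \<Longrightarrow>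
    f = (\<Sum>m\<in>M. Poly_Mapping.single m (Poly_Mapping.lookup f m))"
  by (rule poly_mapping_eqI)
    (auto simp: lookup_sum lookup_single when_def sum.delta not_in_keys_iff_lookup_eq_zero subset_eq
      simp flip: lookup_not_eq_zero_eq_in_keys)

text \<open>The case of a single term concerns only monomials of \<open>f\<close> itself, so
  hypotheses on the support of \<open>f\<close> stay usable inside the induction.\<close>

lemma poly_mapping_monom_induct [case_names zero single add]:
  fixes f :: "'a \<Rightarrow>\<^sub>0 'b::comm_monoid_add"
  assumes "P 0" "\<And>m. m \<in> Poly_Mapping.keys f \<Longrightarrow> P (Poly_Mapping.single m (Poly_Mapping.lookup f m))"
    "\<And>g h. P g \<Longrightarrow> P h \<Longrightarrow> P (g + h)"
  shows "P f"
proof -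
  have "P (\<Sum>m\<in>M. Poly_Mapping.single m (Poly_Mapping.lookup f m))" if "finite M" "M \<subseteq> Poly_Mapping.keys f" for M
    using that by (induction M rule: finite_induct) (auto intro: assms)
  from this[of "Poly_Mapping.keys f"] show ?thesis
    using sum_single_keys[of "Poly_Mapping.keys f" f] by simp
qed

section \<open>Supports, weights and homogeneous monomials\<close>

lemma keys_plus_subset:
  assumes "Poly_Mapping.keys f \<subseteq> M" "Poly_Mapping.keys g \<subseteq> M"
  shows "Poly_Mapping.keys (f + g) \<subseteq> M"
  using assms Poly_Mapping.keys_add[of f g] by blast

lemma keys_minus_subset:
  fixes f g :: "'a \<Rightarrow>\<^sub>0 'b::ab_group_add"
  assumes "Poly_Mapping.keys f \<subseteq> M" "Poly_Mapping.keys g \<subseteq> M"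
  shows "Poly_Mapping.keys (f - g) \<subseteq> M"
  using assms by (auto simp: in_keys_iff lookup_minus subset_eq)

lemma keys_Const_times_subset:
  "Poly_Mapping.keys f \<subseteq> M \<Longrightarrow> Poly_Mapping.keys (Const c * f) \<subseteq> M"
  by (auto simp: in_keys_iff subset_eq)

lemma keys_add_nat:
  fixes m m' :: "'a \<Rightarrow>\<^sub>0 nat"
  shows "Poly_Mapping.keys (m + m') = Poly_Mapping.keys m \<union> Poly_Mapping.keys m'"
  by (auto simp: in_keys_iff lookup_add)

text \<open>Constant weight 1 gives the total degree; other weights single out the leading monomials
  for division with remainder.\<close>

definition wt :: "(nat \<Rightarrow> nat) \<Rightarrow> (nat \<Rightarrow>\<^sub>0 nat) \<Rightarrow> nat" where
  "wt \<omega> m = (\<Sum>v\<in>Poly_Mapping.keys m. \<omega> v * Poly_Mapping.lookup m v)"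

lemma wt_add: "wt \<omega> (m + m') = wt \<omega> m + wt \<omega> m'"
  unfolding wt_def by (rule setsum_keys_plus_distrib) (simp_all add: distrib_left)

lemma wt_single: "wt \<omega> (Poly_Mapping.single v k) = \<omega> v * k"
  by (simp add: wt_def)

lemma mon_deg_wt: "mon_deg m = wt (\<lambda>_. 1) m"
  by (simp add: mon_deg_def wt_def)

lemma mon_deg_add: "mon_deg (m + m') = mon_deg m + mon_deg m'"
  by (simp only: mon_deg_wt wt_add)

lemma mon_deg_single [simp]: "mon_deg (Poly_Mapping.single v k) = k"
  by (simp add: mon_deg_wt wt_single)

lemma mon_deg_0 [simp]: "mon_deg 0 = 0"
  by (simp add: mon_deg_def)

definition hmons :: "nat set \<Rightarrow> nat \<Rightarrow> (nat \<Rightarrow>\<^sub>0 nat) set" where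
  "hmons W k = {m. Poly_Mapping.keys m \<subseteq> W \<and> mon_deg m = k}"

lemma hom_poly_hmons: "hom_poly n d f \<longleftrightarrow> Poly_Mapping.keys f \<subseteq> hmons {..n} d"
  by (auto simp: hom_poly_def hmons_def)

lemma hmons_add: "m \<in> hmons W j \<Longrightarrow> m' \<in> hmons W k \<Longrightarrow> m + m' \<in> hmons W (j + k)"
  by (auto simp: hmons_def mon_deg_add keys_add_nat)

lemma hmons_add_iff: "m' \<in> hmons W k \<Longrightarrow> m + m' \<in> hmons W (j + k) \<longleftrightarrow> m \<in> hmons W j"
  by (auto simp: hmons_def mon_deg_add keys_add_nat)

lemma hmons_single: "v \<in> W \<Longrightarrow> Poly_Mapping.single v k \<in> hmons W k"
  by (auto simp: hmons_def)

lemma hmons_mono: "V \<subseteq> W \<Longrightarrow> hmons V k \<subseteq> hmons W k"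
  by (auto simp: hmons_def)

lemma keys_mult_hmons:
  assumes "Poly_Mapping.keys f \<subseteq> hmons W j" "Poly_Mapping.keys g \<subseteq> hmons W k"
  shows "Poly_Mapping.keys (f * g) \<subseteq> hmons W (j + k)"
  using keys_mult[of f g] assms by (blast intro: hmons_add)

lemma keys_mult_linear:
  assumes "Poly_Mapping.keys f \<subseteq> hmons W 1" "Poly_Mapping.keys g \<subseteq> hmons W 1"
  shows "Poly_Mapping.keys (f * g) \<subseteq> hmons W 2"
  using keys_mult_hmons[OF assms] by (simp only: one_add_one)

lemma keys_Var: "Poly_Mapping.keys (Var i) = {Poly_Mapping.single i 1}"
  by (simp add: Var_def)

lemma keys_Var_hmons: "i \<in> W \<Longrightarrow> Poly_Mapping.keys (Var i) \<subseteq> hmons W 1"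
  by (simp add: keys_Var hmons_single)

lemma mon_deg_0_iff: "mon_deg m = 0 \<longleftrightarrow> m = 0"
  by (auto simp: mon_deg_def in_keys_iff intro!: poly_mapping_eqI)

lemma hmons_0: "hmons W 0 = {0}"
  by (auto simp: hmons_def mon_deg_0_iff)

lemma hmons_minus_single:
  assumes "m \<in> hmons W (Suc k)" "i \<in> Poly_Mapping.keys m"
  obtains m' where "m' \<in> hmons W k" "m = Poly_Mapping.single i 1 + m'"
proof -
  let ?m' = "m - Poly_Mapping.single i 1"
  have m: "m = Poly_Mapping.single i 1 + ?m'"
    by (rule poly_mapping_eqI)
      (use assms in \<open>auto simp: lookup_add lookup_minus lookup_single when_def in_keys_iff\<close>)
  have "Poly_Mapping.single i 1 + ?m' \<in> hmons W (Suc k)" using m assms by simp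
  then have "?m' \<in> hmons W k" by (auto simp: hmons_def mon_deg_add keys_add_nat)
  then show ?thesis using that m by blast
qed

lemma hmons_SucE:
  assumes "m \<in> hmons W (Suc k)"
  obtains i m' where "i \<in> W" "m' \<in> hmons W k" "m = Poly_Mapping.single i 1 + m'"
proof -
  from assms have "mon_deg m \<noteq> 0" by (auto simp: hmons_def)
  then have "Poly_Mapping.keys m \<noteq> {}" by (simp add: mon_deg_0_iff)
  then obtain i where i: "i \<in> Poly_Mapping.keys m" by blast
  with assms have "i \<in> W" by (auto simp: hmons_def)
  with hmons_minus_single[OF assms i] that show ?thesis by blast
qed

lemma hmons_1: "hmons W 1 = (\<lambda>i. Poly_Mapping.single i 1) ` W"
proof
  show "hmons W 1 \<subseteq> (\<lambda>i. Poly_Mapping.single i 1) ` W"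
  proof
    fix m assume "m \<in> hmons W 1"
    then have "m \<in> hmons W (Suc 0)" by simp
    then show "m \<in> (\<lambda>i. Poly_Mapping.single i 1) ` W"
      by (rule hmons_SucE) (simp add: hmons_0)
  qed
qed (auto intro: hmons_single)

subsection \<open>Substitution\<close>

definition eval_mon :: "(nat \<Rightarrow> mpoly) \<Rightarrow> (nat \<Rightarrow>\<^sub>0 nat) \<Rightarrow> mpoly" where
  "eval_mon \<sigma> m = (\<Prod>v\<in>Poly_Mapping.keys m. \<sigma> v ^ Poly_Mapping.lookup m v)"

definition subst :: "(nat \<Rightarrow> mpoly) \<Rightarrow> mpoly \<Rightarrow> mpoly" where
  "subst \<sigma> f = (\<Sum>m\<in>Poly_Mapping.keys f. Const (Poly_Mapping.lookup f m) * eval_mon \<sigma> m)"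

lemma eval_mon_superset:
  assumes "finite V" "Poly_Mapping.keys m \<subseteq> V"
  shows "eval_mon \<sigma> m = (\<Prod>v\<in>V. \<sigma> v ^ Poly_Mapping.lookup m v)"
  unfolding eval_mon_def using assms by (intro prod.mono_neutral_left) (auto simp: in_keys_iff)

lemma eval_mon_add: "eval_mon \<sigma> (m + m') = eval_mon \<sigma> m * eval_mon \<sigma> m'"
proof -
  let ?V = "Poly_Mapping.keys m \<union> Poly_Mapping.keys m'"
  have "eval_mon \<sigma> n = (\<Prod>v\<in>?V. \<sigma> v ^ Poly_Mapping.lookup n v)"
    if "n \<in> {m, m', m + m'}" for n
    using that by (intro eval_mon_superset) (auto simp: keys_add_nat)
  then show ?thesis by (simp add: lookup_add power_add prod.distrib)
qed

lemma eval_mon_0 [simp]: "eval_mon \<sigma> 0 = 1"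
  by (simp add: eval_mon_def)

lemma eval_mon_single [simp]: "eval_mon \<sigma> (Poly_Mapping.single v k) = \<sigma> v ^ k"
  by (simp add: eval_mon_def)

lemma subst_single: "subst \<sigma> (Poly_Mapping.single m c) = Const c * eval_mon \<sigma> m"
  by (simp add: subst_def)

lemma subst_Var [simp]: "subst \<sigma> (Var i) = \<sigma> i"
  by (simp add: Var_def subst_single)

lemma subst_Const [simp]: "subst \<sigma> (Const c) = Const c"
  unfolding Const_def[of c] subst_single by (simp add: Const_def)

lemma subst_0 [simp]: "subst \<sigma> 0 = 0" and subst_1 [simp]: "subst \<sigma> 1 = 1"
  using subst_Const[of \<sigma> 0] subst_Const[of \<sigma> 1] by simp_all

lemma subst_add [simp]: "subst \<sigma> (f + g) = subst \<sigma> f + subst \<sigma> g"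
  unfolding subst_def by (rule setsum_keys_plus_distrib) (simp_all add: Const_add distrib_right)

lemma subst_uminus [simp]: "subst \<sigma> (- f) = - subst \<sigma> f"
  using subst_add[of \<sigma> f "- f"] by (simp add: eq_neg_iff_add_eq_0 add.commute)

lemma subst_diff [simp]: "subst \<sigma> (f - g) = subst \<sigma> f - subst \<sigma> g"
  using subst_add[of \<sigma> f "- g"] by simp

lemma subst_mult [simp]: "subst \<sigma> (f * g) = subst \<sigma> f * subst \<sigma> g"
proof (induction f rule: poly_mapping_monom_induct)
  case (single m)
  show ?case
  proof (induction g rule: poly_mapping_monom_induct)
    case (single m')
    show ?case
      by (simp add: mult_single subst_single eval_mon_add Const_mult algebra_simps)
  qed (simp_all add: distrib_left)
qed (simp_all add: distrib_right)

lemma subst_power [simp]: "subst \<sigma> (f ^ k) = subst \<sigma> f ^ k"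
  by (induction k) simp_all

lemma single_eval_mon: "Poly_Mapping.single m c = Const c * eval_mon Var m"
proof -
  have "Poly_Mapping.single m 1 = eval_mon Var m"
  proof (induction "mon_deg m" arbitrary: m)
    case 0
    then show ?case by (simp add: mon_deg_0_iff)
  next
    case (Suc k)
    then have "m \<in> hmons UNIV (Suc k)" by (simp add: hmons_def)
    then obtain i m' where m: "m' \<in> hmons UNIV k" "m = Poly_Mapping.single i 1 + m'"
      by (rule hmons_SucE)
    then have "Poly_Mapping.single m' 1 = eval_mon Var m'" using Suc(1) by (simp add: hmons_def)
    moreover have "Poly_Mapping.single m 1 = Var i * Poly_Mapping.single m' 1"
      by (simp add: m(2) Var_def mult_single)
    ultimately show ?case by (simp add: m(2) eval_mon_add)
  qed
  moreover have "Poly_Mapping.single m c = Const c * Poly_Mapping.single m 1"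
    by (simp add: Const_def mult_single)
  ultimately show ?thesis by simp
qed

lemma subst_ident:
  assumes "\<And>m v. m \<in> Poly_Mapping.keys f \<Longrightarrow> v \<in> Poly_Mapping.keys m \<Longrightarrow> \<sigma> v = Var v"
  shows "subst \<sigma> f = f"
proof (induction f rule: poly_mapping_monom_induct)
  case (single m)
  from assms[OF single(1)] have "eval_mon \<sigma> m = eval_mon Var m"
    unfolding eval_mon_def by (intro prod.cong) auto
  then show ?case unfolding subst_single unfolding single_eval_mon[of m] by simp
qed simp_all

lemma dvd_diff_mult:
  fixes a :: "'a::comm_ring_1"
  assumes "a dvd x - x'" "a dvd y - y'"
  shows "a dvd x * y - x' * y'"
proof -
  have "x * y - x' * y' = x * (y - y') + (x - x') * y'" by (simp add: algebra_simps)
  with assms show ?thesis by simp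
qed

lemma dvd_diff_power:
  fixes a :: "'a::comm_ring_1"
  assumes "a dvd x - x'"
  shows "a dvd x ^ k - x' ^ k"
  by (induction k) (auto intro: dvd_diff_mult assms)

lemma dvd_diff_prod:
  fixes a :: "'a::comm_ring_1"
  assumes "finite V" "\<And>v. v \<in> V \<Longrightarrow> a dvd x v - x' v"
  shows "a dvd prod x V - prod x' V"
  using assms by (induction V rule: finite_induct) (auto intro: dvd_diff_mult)

text \<open>Congruence modulo \<open>a\<close> respects sums and products, so replacing variables by
  congruent polynomials changes \<open>f\<close> only by a multiple of \<open>a\<close>.\<close>

lemma dvd_diff_subst:
  assumes "\<And>v. a dvd Var v - \<sigma> v"
  shows "a dvd f - subst \<sigma> f"
proof (induction f rule: poly_mapping_monom_induct)
  case (single m)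
  have "a dvd eval_mon Var m - eval_mon \<sigma> m"
    unfolding eval_mon_def by (intro dvd_diff_prod dvd_diff_power assms) simp
  then show ?case
    unfolding subst_single unfolding single_eval_mon[of m] by (simp flip: right_diff_distrib)
next
  case (add g h)
  have "g + h - subst \<sigma> (g + h) = (g - subst \<sigma> g) + (h - subst \<sigma> h)" by simp
  with add show ?case by (simp only: dvd_add)
qed simp

text \<open>The multiples of \<open>Var i - s\<close> are the kernel of the substitution of
  \<open>s\<close> for \<open>Var i\<close>. The hypothesis makes this substitution kill
  \<open>Var i - s\<close> itself; it holds when \<open>s\<close> does not involve the
  variable.\<close>

lemma dvd_Var_minus_iff:
  assumes "subst (Var(i := s)) s = s"
  shows "Var i - s dvd f \<longleftrightarrow> subst (Var(i := s)) f = 0"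
proof
  assume "Var i - s dvd f"
  then show "subst (Var(i := s)) f = 0" using assms by (auto elim!: dvdE)
next
  assume "subst (Var(i := s)) f = 0"
  moreover have "Var i - s dvd f - subst (Var(i := s)) f"
    by (rule dvd_diff_subst) auto
  ultimately show "Var i - s dvd f" by simp
qed

text \<open>Divisibility is vanishing under a ring homomorphism into a domain, hence a prime
  condition.\<close>

lemma Var_minus_prime:
  assumes "subst (Var(i := s)) s = s" "Var i - s dvd f * g"
  shows "Var i - s dvd f \<or> Var i - s dvd g"
  using assms by (simp add: dvd_Var_minus_iff)

lemma Var_prime: "Var i dvd f * g \<Longrightarrow> Var i dvd f \<or> Var i dvd g"
  using Var_minus_prime[of i 0 f g] by simp

lemma Var_dvd_iff: "Var i dvd f \<longleftrightarrow> subst (Var(i := 0)) f = 0"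
  using dvd_Var_minus_iff[of i 0 f] by simp

lemma Var_nonzero [simp]: "Var i \<noteq> 0"
  using keys_Var[of i] by force

lemma not_dvd_1:
  fixes f :: mpoly
  assumes "Poly_Mapping.keys f \<subseteq> hmons W k" "k > 0"
  shows "\<not> f dvd 1"
proof
  assume "f dvd 1"
  then obtain g where g: "1 = f * g" by (rule dvdE)
  have "subst (\<lambda>_. 0) f = 0"
    unfolding subst_def
  proof (rule sum.neutral, rule ballI)
    fix m assume "m \<in> Poly_Mapping.keys f"
    then have "mon_deg m \<noteq> 0" using assms by (auto simp: hmons_def)
    then have "m \<noteq> 0" by (simp add: mon_deg_0_iff)
    then obtain i where "Poly_Mapping.lookup m i \<noteq> 0" by (metis poly_mapping_eqI lookup_zero)
    then have "eval_mon (\<lambda>_. 0) m = 0" unfolding eval_mon_def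
      by (intro prod_zero) (auto simp: in_keys_iff)
    then show "Const (Poly_Mapping.lookup f m) * eval_mon (\<lambda>_. 0) m = 0" by simp
  qed
  then have "subst (\<lambda>_. 0) (f * g) = 0" by simp
  then show False unfolding g[symmetric] by simp
qed

subsection \<open>Homogeneous parts\<close>

definition part :: "(nat \<Rightarrow>\<^sub>0 nat) set \<Rightarrow> mpoly \<Rightarrow> mpoly" where
  "part M f = (\<Sum>m\<in>Poly_Mapping.keys f \<inter> M. Poly_Mapping.single m (Poly_Mapping.lookup f m))"

lemma lookup_part: "Poly_Mapping.lookup (part M f) m = (if m \<in> M then Poly_Mapping.lookup f m else 0)"
  by (auto simp: part_def lookup_sum lookup_single when_def sum.delta in_keys_iff)

lemma keys_part: "Poly_Mapping.keys (part M f) \<subseteq> M"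
  by (auto simp: in_keys_iff lookup_part split: if_splits)

lemma part_ident: "Poly_Mapping.keys f \<subseteq> M \<Longrightarrow> part M f = f"
  by (rule poly_mapping_eqI) (auto simp: lookup_part in_keys_iff subset_eq)

lemma part_add: "part M (f + g) = part M f + part M g"
  by (rule poly_mapping_eqI) (simp add: lookup_part lookup_add)

lemma part_single: "part M (Poly_Mapping.single m c) = (if m \<in> M then Poly_Mapping.single m c else 0)"
  by (rule poly_mapping_eqI) (auto simp: lookup_part lookup_single when_def)

lemma part_0 [simp]: "part M 0 = 0"
  by (simp add: part_def)

text \<open>Multiplication by a form shifts degrees by a constant. This is how the arbitrary
  cofactors in an ideal membership are replaced by homogeneous ones.\<close>

lemma part_mult:
  assumes "Poly_Mapping.keys p \<subseteq> hmons W j"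
  shows "part (hmons W (k + j)) (f * p) = part (hmons W k) f * p"
proof (induction f rule: poly_mapping_monom_induct)
  case (single m)
  show ?case
  proof (induction p rule: poly_mapping_monom_induct)
    case (single m')
    then have "m' \<in> hmons W j" using assms by blast
    then show ?case by (simp add: mult_single part_single hmons_add_iff)
  qed (simp_all add: distrib_left part_add)
qed (simp_all add: distrib_right part_add)

subsection \<open>Division with remainder\<close>

text \<open>Rewriting \<open>\<mu> + m'\<close> through \<open>p\<close> replaces it by monomials
  \<open>m' + n\<close> with \<open>n\<close> in \<open>r\<close>, which have strictly smaller
  weight. A weight whose maximum on \<open>p\<close> is attained only at \<open>\<mu>\<close> thus
  does the work of a monomial order.\<close>

lemma division_by_leading_monomial:
  fixes f p r :: mpoly
  assumes p: "p = Poly_Mapping.single \<mu> 1 + r"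
    and r: "\<And>m. m \<in> Poly_Mapping.keys r \<Longrightarrow> wt \<omega> m < wt \<omega> \<mu>"
  shows "\<exists>s q. f = s * p + q \<and> (\<forall>m\<in>Poly_Mapping.keys q. \<forall>m'. m \<noteq> \<mu> + m')"
proof -
  define P where "P f \<longleftrightarrow> (\<exists>s q. f = s * p + q \<and> (\<forall>m\<in>Poly_Mapping.keys q. \<forall>m'. m \<noteq> \<mu> + m'))" for f
  have P_zero: "P 0" unfolding P_def by (intro exI[of _ 0]) simp
  have P_add: "P (g + h)" if "P g" "P h" for g h
  proof -
    from that obtain s q s' q' where
      "g = s * p + q" "\<forall>m\<in>Poly_Mapping.keys q. \<forall>m'. m \<noteq> \<mu> + m'"
      "h = s' * p + q'" "\<forall>m\<in>Poly_Mapping.keys q'. \<forall>m'. m \<noteq> \<mu> + m'"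
      unfolding P_def by blast
    then show ?thesis unfolding P_def
      using Poly_Mapping.keys_add[of q q']
      by (intro exI[of _ "s + s'"] exI[of _ "q + q'"]) (auto simp: algebra_simps subset_eq)
  qed
  have P_mult: "P (g + s * p)" if "P g" for g s
  proof -
    from that obtain s' q where "g = s' * p + q" "\<forall>m\<in>Poly_Mapping.keys q. \<forall>m'. m \<noteq> \<mu> + m'"
      unfolding P_def by blast
    then show ?thesis unfolding P_def
      by (intro exI[of _ "s + s'"] exI[of _ q]) (simp add: algebra_simps)
  qed
  have mono: "P (Poly_Mapping.single m c)" for m c
  proof (induction "wt \<omega> m" arbitrary: m c rule: less_induct)
    case less
    show ?case
    proof (cases "\<exists>m'. m = \<mu> + m'")
      case False
      then show ?thesis unfolding P_def
        by (intro exI[of _ 0] exI[of _ "Poly_Mapping.single m c"]) auto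
    next
      case True
      then obtain m' where m: "m = \<mu> + m'" by blast
      let ?t = "Poly_Mapping.single m' c"
      have "P (- (?t * r))"
      proof (rule poly_mapping_monom_induct[where f = "- (?t * r)" and P = P])
        fix n assume "n \<in> Poly_Mapping.keys (- (?t * r))"
        then have "n \<in> Poly_Mapping.keys (?t * r)" by (simp add: in_keys_iff)
        then obtain n' where n': "n = m' + n'" "n' \<in> Poly_Mapping.keys r"
          using keys_mult[of ?t r] by (auto split: if_splits)
        then have "wt \<omega> n < wt \<omega> m" using r by (simp add: m wt_add)
        then show "P (Poly_Mapping.single n (Poly_Mapping.lookup (- (?t * r)) n))" by (rule less)
      qed (use P_zero P_add in auto)
      from P_mult[OF this, of ?t] show ?thesis
        by (simp add: p m algebra_simps mult_single)
    qed
  qed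
  have "P f"
    by (induction f rule: poly_mapping_monom_induct) (use P_zero P_add mono in auto)
  then show ?thesis by (simp only: P_def)
qed

subsection \<open>The strata and their closures\<close>

lemma in_ideal_Nil: "in_ideal [] g \<longleftrightarrow> g = 0"
  by (simp add: in_ideal_def)

lemma in_ideal_single: "in_ideal [p] g \<longleftrightarrow> p dvd g"
proof
  assume "in_ideal [p] g"
  then obtain hs where "length hs = Suc 0" "g = sum_list (map2 (*) hs [p])"
    by (auto simp: in_ideal_def)
  moreover from this obtain a where "hs = [a]" by (auto simp: length_Suc_conv)
  ultimately show "p dvd g" by simp
next
  assume "p dvd g"
  then obtain a where "g = p * a" by (rule dvdE)
  then show "in_ideal [p] g" unfolding in_ideal_def
    by (intro exI[of _ "[a]"]) (simp add: mult.commute)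
qed

lemma in_ideal_pair: "in_ideal [p, q] g \<longleftrightarrow> (\<exists>a b. g = a * p + b * q)"
proof
  assume "in_ideal [p, q] g"
  then obtain hs where "length hs = Suc (Suc 0)" "g = sum_list (map2 (*) hs [p, q])"
    by (auto simp: in_ideal_def)
  moreover from this obtain a b where "hs = [a, b]" by (auto simp: length_Suc_conv)
  ultimately show "\<exists>a b. g = a * p + b * q" by (intro exI[of _ a] exI[of _ b]) simp
next
  assume "\<exists>a b. g = a * p + b * q"
  then obtain a b where "g = a * p + b * q" by blast
  then show "in_ideal [p, q] g" unfolding in_ideal_def by (intro exI[of _ "[a, b]"]) simp
qed

lemma regular_seq_pair:
  "regular_seq [p, q] \<longleftrightarrow>
    (\<forall>a b. 1 \<noteq> a * p + b * q) \<and> p \<noteq> 0 \<and> (\<forall>g. p dvd g * q \<longrightarrow> p dvd g)"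
proof -
  have two: "(\<forall>i<length [p, q]. Q i) \<longleftrightarrow> Q 0 \<and> Q 1" for Q
    by (auto simp: less_Suc_eq)
  have "(\<forall>g. g * p = 0 \<longrightarrow> g = 0) \<longleftrightarrow> p \<noteq> 0"
  proof
    assume "\<forall>g. g * p = 0 \<longrightarrow> g = 0"
    from this[rule_format, of 1] show "p \<noteq> 0" by auto
  qed simp
  then show ?thesis
    unfolding regular_seq_def two
    by (simp only: take_0 take_Suc_Cons One_nat_def nth_Cons_0 nth_Cons_Suc in_ideal_Nil
        in_ideal_single in_ideal_pair) simp
qed

lemma Fset_pair:
  "f \<in> Fset [i, j] n d \<longleftrightarrow> (\<exists>p q g h. hom_poly n i p \<and> hom_poly n j q \<and>
     hom_poly n (d - i) g \<and> hom_poly n (d - j) h \<and> regular_seq [p, q] \<and> f = p * g + q * h)"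
proof
  assume "f \<in> Fset [i, j] n d"
  then obtain fs gs where fg: "length fs = Suc (Suc 0)" "length gs = Suc (Suc 0)"
    "\<And>h. h < 2 \<Longrightarrow> hom_poly n ([i, j] ! h) (fs ! h) \<and> hom_poly n (d - [i, j] ! h) (gs ! h)"
    "regular_seq fs" "f = sum_list (map2 (*) fs gs)"
    by (auto simp: Fset_def)
  then obtain p q g h where "fs = [p, q]" "gs = [g, h]" by (auto simp: length_Suc_conv)
  with fg(3)[of 0] fg(3)[of 1] fg(4,5) show "\<exists>p q g h. hom_poly n i p \<and> hom_poly n j q \<and>
     hom_poly n (d - i) g \<and> hom_poly n (d - j) h \<and> regular_seq [p, q] \<and> f = p * g + q * h"
    by auto
next
  assume "\<exists>p q g h. hom_poly n i p \<and> hom_poly n j q \<and>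
     hom_poly n (d - i) g \<and> hom_poly n (d - j) h \<and> regular_seq [p, q] \<and> f = p * g + q * h"
  then obtain p q g h where "hom_poly n i p" "hom_poly n j q"
     "hom_poly n (d - i) g" "hom_poly n (d - j) h" "regular_seq [p, q]" "f = p * g + q * h"
    by blast
  then show "f \<in> Fset [i, j] n d"
    unfolding Fset_def mem_Collect_eq
    by (intro exI[of _ "[p, q]"] exI[of _ "[g, h]"]) (simp add: less_Suc_eq)
qed

text \<open>A polynomial condition on the coefficients is continuous along \<open>F\<close>, so if
  it vanishes for all \<open>t \<noteq> 0\<close> it vanishes at 0.\<close>

lemma zariski_closure_limit:
  assumes S: "\<And>t. t \<noteq> 0 \<Longrightarrow> F t \<in> S"
    and cont: "\<And>m. isCont (\<lambda>t::complex. Poly_Mapping.lookup (F t) m) 0"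
  shows "F 0 \<in> zariski_closure S"
  unfolding zariski_closure_def mem_Collect_eq
proof (intro allI impI)
  fix P assume P: "\<forall>g\<in>S. coeff_eval P g = 0"
  let ?c = "\<lambda>t. coeff_eval P (F t)"
  have "isCont ?c 0"
    unfolding coeff_eval_def by (intro continuous_intros cont)
  then have "(?c \<longlongrightarrow> ?c 0) (at 0)" by (simp add: isCont_def)
  moreover have "(?c \<longlongrightarrow> 0) (at 0)"
    by (rule tendsto_eventually) (use S P in \<open>auto simp: eventually_at_filter\<close>)
  ultimately show "coeff_eval P (F 0) = 0"
    by (rule tendsto_unique[OF at_neq_bot])
qed

section \<open>The degenerating pencil of quadrics and membership in the strata\<close>

lemma Const_eq_0_iff [simp]: "Const c = 0 \<longleftrightarrow> c = 0"
proof
  assume "Const c = 0"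
  then have "Poly_Mapping.lookup (Const c) 0 = 0" by (simp only: lookup_zero)
  then show "c = 0" by (simp add: Const_def)
qed simp

text \<open>The first quadric is the product of the primes \<open>l t\<close> and
  \<open>l (- t)\<close>. No \<open>l s\<close> divides the second quadric: after the substitution
  for \<open>Var 0\<close> the term \<open>t x\<^sub>2\<^sup>2\<close> survives, as the point with
  \<open>x\<^sub>2 = 1\<close> and all other coordinates 0 shows. The primes are then cancelled one
  after the other.\<close>

lemma regular_degenerating_pencil:
  assumes t: "t \<noteq> 0"
  shows "regular_seq [Var 0 ^ 2 - Const (t\<^sup>2) * Var 3 ^ 2, Var 0 * Var 1 + Const t * Var 2 ^ 2]"
    (is "regular_seq [?p, ?q]")
proof -
  define l where "l s = Var 0 - Const s * Var 3" for s
  have p: "?p = l t * l (- t)"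
    by (simp add: l_def power2_eq_square Const_mult Const_uminus algebra_simps)
  have prime: "l s dvd g * h \<Longrightarrow> l s dvd g \<or> l s dvd h" for s g h
    unfolding l_def by (rule Var_minus_prime) simp
  have ndvd: "\<not> l s dvd ?q" for s
  proof
    assume "l s dvd ?q"
    then have "subst (Var(0 := Const s * Var 3)) ?q = 0"
      unfolding l_def by (subst (asm) dvd_Var_minus_iff) simp_all
    then have "subst (\<lambda>v. if v = 2 then 1 else 0) (subst (Var(0 := Const s * Var 3)) ?q) = 0"
      by simp
    then show False using t by simp
  qed
  have l0: "l s \<noteq> 0" for s
  proof
    assume "l s = 0"
    then have "subst (\<lambda>v. if v = 0 then 1 else 0) (l s) = 0" by simp
    then show False by (simp add: l_def)
  qed
  show ?thesis
    unfolding regular_seq_pair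
  proof (intro conjI allI impI)
    fix a b
    show "1 \<noteq> a * ?p + b * ?q"
    proof
      assume "1 = a * ?p + b * ?q"
      then have "subst (\<lambda>_. 0) 1 = subst (\<lambda>_. 0) (a * ?p + b * ?q)" by simp
      then show False by simp
    qed
  next
    show "?p \<noteq> 0" unfolding p using l0 by simp
  next
    fix g assume "?p dvd g * ?q"
    then have d: "l t * l (- t) dvd g * ?q" unfolding p .
    then have "l t dvd g * ?q" by (rule dvd_mult_left)
    with ndvd prime have "l t dvd g" by blast
    then obtain g' where g': "g = l t * g'" by (rule dvdE)
    from d have "l (- t) dvd g' * ?q" unfolding g' mult.assoc using l0 by simp
    with ndvd prime have "l (- t) dvd g'" by blast
    then show "?p dvd g" unfolding p g' by simp
  qed
qed

lemma plane_times_in_closure: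
  assumes A: "Poly_Mapping.keys A0 \<subseteq> hmons {..3} (Suc k)" "Poly_Mapping.keys A1 \<subseteq> hmons {..3} (Suc k)"
    "Poly_Mapping.keys A2 \<subseteq> hmons {..3} k"
  shows "Var 0 * (Var 0 * A0 + Var 1 * A1 + Var 2 ^ 2 * A2) \<in> zariski_closure (Fset [2,2] 3 (k + 3))"
proof -
  define q1 where "q1 t = Var 0 ^ 2 - Const (t\<^sup>2) * Var 3 ^ 2" for t
  define q2 where "q2 t = Var 0 * Var 1 + Const t * Var 2 ^ 2" for t
  define c where "c t = Var 0 * Var 2 ^ 2 + Const t * (Var 1 * Var 3 ^ 2)" for t
  define F where "F t = A0 * q1 t + A1 * q2 t + A2 * c t" for t
  have V: "Poly_Mapping.keys (Var i * Var j) \<subseteq> hmons {..3} 2" if "i \<le> 3" "j \<le> 3" for i j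
    by (intro keys_mult_linear keys_Var_hmons) (use that in simp_all)
  have "F t \<in> Fset [2,2] 3 (k + 3)" if t: "t \<noteq> 0" for t
  proof -
    \<comment> \<open>The factor \<open>1 / t\<close> enters only the cofactors. The form
      \<open>F t\<close> is polynomial in \<open>t\<close>, so it has a value at
      \<open>t = 0\<close>, where the cofactors do not.\<close>
    let ?g = "A0 - Const (inverse t) * (Var 1 * A2)" and ?h = "A1 + Const (inverse t) * (Var 0 * A2)"
    have "q1 t * ?g + q2 t * ?h = A0 * q1 t + A1 * q2 t
        + Const (inverse t) * A2 * (Var 0 * q2 t - Var 1 * q1 t)"
      by (simp add: algebra_simps)
    also have "Var 0 * q2 t - Var 1 * q1 t = Const t * c t"
      by (simp add: q1_def q2_def c_def Const_mult power2_eq_square algebra_simps)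
    also have "Const (inverse t) * A2 * (Const t * c t) = Const t * Const (inverse t) * (A2 * c t)"
      by (simp add: algebra_simps)
    also have "Const t * Const (inverse t) = 1" using t by (rule Const_inverse)
    finally have eq: "F t = q1 t * ?g + q2 t * ?h" by (simp add: F_def)
    have "Poly_Mapping.keys (Var 1 * A2) \<subseteq> hmons {..3} (1 + k)"
      "Poly_Mapping.keys (Var 0 * A2) \<subseteq> hmons {..3} (1 + k)"
      by (intro keys_mult_hmons keys_Var_hmons A; simp)+
    then have "Poly_Mapping.keys ?g \<subseteq> hmons {..3} (Suc k)" "Poly_Mapping.keys ?h \<subseteq> hmons {..3} (Suc k)"
      by (intro keys_minus_subset keys_plus_subset keys_Const_times_subset A; simp)+
    then have gh: "hom_poly 3 (k + 3 - 2) ?g" "hom_poly 3 (k + 3 - 2) ?h"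
      by (simp_all add: hom_poly_hmons)
    have q: "hom_poly 3 2 (q1 t)" "hom_poly 3 2 (q2 t)"
      unfolding hom_poly_hmons q1_def q2_def power2_eq_square
      by (intro keys_minus_subset keys_plus_subset keys_Const_times_subset V; simp)+
    have "regular_seq [q1 t, q2 t]"
      unfolding q1_def q2_def by (rule regular_degenerating_pencil[OF t])
    with gh eq q show ?thesis
      unfolding Fset_pair by (intro exI[of _ "q1 t"] exI[of _ "q2 t"] exI[of _ ?g] exI[of _ ?h] conjI)
  qed
  moreover have "isCont (\<lambda>t. Poly_Mapping.lookup (F t) m) 0" for m
  proof -
    define B where "B = Var 0 * (Var 0 * A0 + Var 1 * A1 + Var 2 ^ 2 * A2)"
    define U where "U = A1 * Var 2 ^ 2 + A2 * (Var 1 * Var 3 ^ 2)"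
    define W where "W = A0 * Var 3 ^ 2"
    have "F t = B + Const t * U - Const (t\<^sup>2) * W" for t
      by (simp add: F_def q1_def q2_def c_def B_def U_def W_def algebra_simps power2_eq_square)
    then show ?thesis by (simp add: lookup_add lookup_minus)
  qed
  ultimately have "F 0 \<in> zariski_closure (Fset [2,2] 3 (k + 3))"
    by (rule zariski_closure_limit)
  then show ?thesis
    by (simp add: F_def q1_def q2_def c_def algebra_simps power2_eq_square)
qed

text \<open>The cone contains 0, so a form found outside it is automatically nonzero.\<close>

lemma zero_in_Fset: "0 \<in> Fset [2,2] 3 d"
proof -
  have V: "Poly_Mapping.keys (Var i * Var j) \<subseteq> hmons {..3} 2" if "i \<le> 3" "j \<le> 3" for i j
    by (intro keys_mult_linear keys_Var_hmons) (use that in simp_all)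
  have q: "hom_poly 3 2 (Var 0 ^ 2 - Const (1\<^sup>2) * Var 3 ^ 2)" "hom_poly 3 2 (Var 0 * Var 1 + Const 1 * Var 2 ^ 2)"
    unfolding hom_poly_hmons power2_eq_square
    by (intro keys_minus_subset keys_plus_subset keys_Const_times_subset V; simp)+
  have z: "hom_poly 3 k 0" for k by (simp add: hom_poly_def)
  show ?thesis
    unfolding Fset_pair
    by (rule exI[of _ "Var 0 ^ 2 - Const (1\<^sup>2) * Var 3 ^ 2"],
        rule exI[of _ "Var 0 * Var 1 + Const 1 * Var 2 ^ 2"], rule exI[of _ 0], rule exI[of _ 0])
      (intro conjI q z regular_degenerating_pencil[OF one_neq_zero], simp)
qed

text \<open>The quartic \<open>Var 1 ^ 4\<close> only completes \<open>Var 0\<close> to a regular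
  sequence; its cofactor is 0.\<close>

lemma plane_times_in_Fset_1_4:
  assumes "Poly_Mapping.keys A \<subseteq> hmons {..3} (d - 1)"
  shows "Var 0 * A \<in> Fset [1,4] 3 d"
proof -
  have pw: "Poly_Mapping.keys (Var 1 ^ k) \<subseteq> hmons {..3} k" for k
  proof (induction k)
    case 0
    show ?case by (simp add: hmons_def)
  next
    case (Suc k)
    have "Poly_Mapping.keys (Var 1 * Var 1 ^ k) \<subseteq> hmons {..3} (1 + k)"
      by (intro keys_mult_hmons keys_Var_hmons Suc) simp
    then show ?case by simp
  qed
  have reg: "regular_seq [Var 0, Var 1 ^ 4]"
    unfolding regular_seq_pair
  proof (intro conjI allI impI)
    fix a b
    show "1 \<noteq> a * Var 0 + b * Var 1 ^ 4"
    proof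
      assume "1 = a * Var 0 + b * Var 1 ^ 4"
      then have "subst (\<lambda>_. 0) 1 = subst (\<lambda>_. 0) (a * Var 0 + b * Var 1 ^ 4)" by simp
      then show False by simp
    qed
  next
    fix g assume "Var 0 dvd g * Var 1 ^ 4"
    moreover have "\<not> Var 0 dvd Var 1 ^ 4" by (simp add: Var_dvd_iff)
    ultimately show "Var 0 dvd g" using Var_prime by blast
  qed simp
  show ?thesis
    unfolding Fset_pair hom_poly_hmons
    by (intro exI[of _ "Var 0"] exI[of _ "Var 1 ^ 4"] exI[of _ A] exI[of _ 0] conjI reg keys_Var_hmons pw assms)
      simp_all
qed

subsection \<open>Reducible members of pencils of conics\<close>

text \<open>A binary quadratic form with coefficients \<open>B\<close>, \<open>2 M\<close>,
  \<open>E\<close> and discriminant zero is the square of a linear form with coefficients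
  \<open>\<beta>\<close>, \<open>\<gamma>\<close>.\<close>

lemma binary_square:
  fixes B M E :: complex
  assumes "M\<^sup>2 = B * E"
  obtains \<beta> \<gamma> where "\<beta>\<^sup>2 = B" "\<gamma>\<^sup>2 = E" "\<beta> * \<gamma> = M"
proof (cases "B = 0")
  case True
  with assms have "M = 0" by simp
  with True that[of 0 "csqrt E"] show ?thesis by simp
next
  case False
  then have nz: "csqrt B \<noteq> 0" by simp
  have "(M / csqrt B)\<^sup>2 = E" using False assms by (simp add: power_divide)
  with that[of "csqrt B" "M / csqrt B"] nz show ?thesis by simp
qed

text \<open>The vanishing expression is four times the determinant of the conic \<open>Q = a
  x\<^sup>2 + b y\<^sup>2 + c z\<^sup>2 + f y z + g x z + h x y\<close>. Completing the square gives
  \<open>4 a Q = (2 a x + h y + g z)\<^sup>2 - R(y, z)\<close>. The discriminant of \<open>R\<close>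
  is a multiple of that determinant, so \<open>R = (\<beta> y + \<gamma> z)\<^sup>2\<close>, and the
  difference of squares factors.\<close>

lemma singular_conic_factors_aux:
  fixes a b c f g h :: complex
  assumes "a \<noteq> 0" "4 * a * b * c + f * g * h - a * f\<^sup>2 - b * g\<^sup>2 - c * h\<^sup>2 = 0"
  shows "\<exists>l1 l2 l3 m1 m2 m3. l1 * m1 = a \<and> l2 * m2 = b \<and> l3 * m3 = c \<and>
    l2 * m3 + l3 * m2 = f \<and> l1 * m3 + l3 * m1 = g \<and> l1 * m2 + l2 * m1 = h"
proof -
  have "(h * g - 2 * a * f)\<^sup>2 - (h\<^sup>2 - 4 * a * b) * (g\<^sup>2 - 4 * a * c)
    = - (4 * a) * (4 * a * b * c + f * g * h - a * f\<^sup>2 - b * g\<^sup>2 - c * h\<^sup>2)"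
    by (simp add: power2_eq_square algebra_simps)
  with assms(2) have "(h * g - 2 * a * f)\<^sup>2 = (h\<^sup>2 - 4 * a * b) * (g\<^sup>2 - 4 * a * c)" by simp
  then obtain \<beta> \<gamma> where \<beta>: "\<beta>\<^sup>2 = h\<^sup>2 - 4 * a * b" "\<gamma>\<^sup>2 = g\<^sup>2 - 4 * a * c" "\<beta> * \<gamma> = h * g - 2 * a * f"
    by (rule binary_square)
  have *: "u / (4 * a) = v \<longleftrightarrow> u = 4 * a * v" for u v using assms(1) by (auto simp: field_simps)
  show ?thesis
  proof (intro exI conjI)
    show "1 / 2 * (2 * a) = a" by simp
    show "(h + \<beta>) / (4 * a) * (h - \<beta>) = b"
      unfolding times_divide_eq_left * using \<beta>(1) by (simp add: algebra_simps power2_eq_square)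
    show "(g + \<gamma>) / (4 * a) * (g - \<gamma>) = c"
      unfolding times_divide_eq_left * using \<beta>(2) by (simp add: algebra_simps power2_eq_square)
    show "(h + \<beta>) / (4 * a) * (g - \<gamma>) + (g + \<gamma>) / (4 * a) * (h - \<beta>) = f"
    proof -
      have "(h + \<beta>) * (g - \<gamma>) + (g + \<gamma>) * (h - \<beta>) = 2 * (h * g - \<beta> * \<gamma>)"
        by (simp add: algebra_simps)
      then show ?thesis
        unfolding times_divide_eq_left add_divide_distrib[symmetric] * by (simp add: \<beta>(3))
    qed
    have half: "u / (4 * a) * (2 * a) = u / 2" for u using assms(1) by simp
    show "1 / 2 * (g - \<gamma>) + (g + \<gamma>) / (4 * a) * (2 * a) = g"
      unfolding half by (simp add: field_simps)
    show "1 / 2 * (h - \<beta>) + (h + \<beta>) / (4 * a) * (2 * a) = h"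
      unfolding half by (simp add: field_simps)
  qed
qed

lemma singular_conic_factors:
  fixes a b c f g h :: complex
  assumes "4 * a * b * c + f * g * h - a * f\<^sup>2 - b * g\<^sup>2 - c * h\<^sup>2 = 0"
  shows "\<exists>l1 l2 l3 m1 m2 m3. l1 * m1 = a \<and> l2 * m2 = b \<and> l3 * m3 = c \<and>
    l2 * m3 + l3 * m2 = f \<and> l1 * m3 + l3 * m1 = g \<and> l1 * m2 + l2 * m1 = h"
proof -
  consider "a \<noteq> 0" | "b \<noteq> 0" | "c \<noteq> 0" | "a = 0" "b = 0" "c = 0" by blast
  then show ?thesis
  proof cases
    case 1
    with assms show ?thesis by (intro singular_conic_factors_aux)
  next
    case 2
    from assms have "4 * b * a * c + g * f * h - b * g\<^sup>2 - a * f\<^sup>2 - c * h\<^sup>2 = 0"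
      by (simp add: algebra_simps)
    from singular_conic_factors_aux[OF 2 this] obtain l1 l2 l3 m1 m2 m3 where
      "l1 * m1 = b" "l2 * m2 = a" "l3 * m3 = c" "l2 * m3 + l3 * m2 = g" "l1 * m3 + l3 * m1 = f"
      "l1 * m2 + l2 * m1 = h" by blast
    then show ?thesis
      by (intro exI[of _ l2] exI[of _ l1] exI[of _ l3] exI[of _ m2] exI[of _ m1] exI[of _ m3])
        (simp add: add.commute)
  next
    case 3
    from assms have "4 * c * b * a + h * g * f - c * h\<^sup>2 - b * g\<^sup>2 - a * f\<^sup>2 = 0"
      by (simp add: algebra_simps)
    from singular_conic_factors_aux[OF 3 this] obtain l1 l2 l3 m1 m2 m3 where
      "l1 * m1 = c" "l2 * m2 = b" "l3 * m3 = a" "l2 * m3 + l3 * m2 = h" "l1 * m3 + l3 * m1 = g"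
      "l1 * m2 + l2 * m1 = f" by blast
    then show ?thesis
      by (intro exI[of _ l3] exI[of _ l2] exI[of _ l1] exI[of _ m3] exI[of _ m2] exI[of _ m1])
        (simp add: add.commute)
  next
    case 4
    \<comment> \<open>Without squares the determinant condition reads \<open>f * g * h = 0\<close>;
      one mixed term is missing and the other two share a variable.\<close>
    with assms consider "f = 0" | "g = 0" | "h = 0" by auto
    then show ?thesis
    proof cases
      case 1
      with 4 show ?thesis
        by (intro exI[of _ 1] exI[of _ 0] exI[of _ 0] exI[of _ 0] exI[of _ h] exI[of _ g]) simp
    next
      case 2
      with 4 show ?thesis
        by (intro exI[of _ 0] exI[of _ 1] exI[of _ 0] exI[of _ h] exI[of _ 0] exI[of _ f]) simp
    next
      case 3
      with 4 show ?thesis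
        by (intro exI[of _ 0] exI[of _ 0] exI[of _ 1] exI[of _ g] exI[of _ f] exI[of _ 0]) simp
    qed
  qed
qed

definition conic :: "complex \<Rightarrow> complex \<Rightarrow> complex \<Rightarrow> complex \<Rightarrow> complex \<Rightarrow> complex \<Rightarrow> mpoly" where
  "conic a b c f g h = Const a * (Var 1 * Var 1) + Const b * (Var 2 * Var 2) + Const c * (Var 3 * Var 3)
     + Const f * (Var 2 * Var 3) + Const g * (Var 1 * Var 3) + Const h * (Var 1 * Var 2)"

lemma conic_add:
  "conic a b c f g h + conic a' b' c' f' g' h' = conic (a + a') (b + b') (c + c') (f + f') (g + g') (h + h')"
  by (simp add: conic_def Const_add algebra_simps)

lemma Const_times_conic: "Const k * conic a b c f g h = conic (k * a) (k * b) (k * c) (k * f) (k * g) (k * h)"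
  by (simp add: conic_def Const_mult algebra_simps)

lemma keys_linear_form:
  "Poly_Mapping.keys (Const a * Var 1 + Const b * Var 2 + Const c * Var 3) \<subseteq> hmons {1..3} 1"
  by (intro keys_plus_subset keys_Const_times_subset keys_Var_hmons) auto

lemma singular_conic_reducible:
  assumes "4 * a * b * c + f * g * h - a * f\<^sup>2 - b * g\<^sup>2 - c * h\<^sup>2 = 0"
  shows "\<exists>l m. Poly_Mapping.keys l \<subseteq> hmons {1..3} 1 \<and> Poly_Mapping.keys m \<subseteq> hmons {1..3} 1 \<and>
    conic a b c f g h = l * m"
proof -
  from singular_conic_factors[OF assms] obtain l1 l2 l3 m1 m2 m3 where
    *: "a = l1 * m1" "b = l2 * m2" "c = l3 * m3" "f = l2 * m3 + l3 * m2" "g = l1 * m3 + l3 * m1"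
    "h = l1 * m2 + l2 * m1" by metis
  have "conic a b c f g h = (Const l1 * Var 1 + Const l2 * Var 2 + Const l3 * Var 3) *
     (Const m1 * Var 1 + Const m2 * Var 2 + Const m3 * Var 3)"
    unfolding * by (simp add: conic_def Const_add Const_mult algebra_simps)
  then show ?thesis using keys_linear_form by blast
qed

lemma quadric_is_conic:
  assumes "Poly_Mapping.keys p \<subseteq> hmons {1..3} 2"
  shows "\<exists>a b c f g h. p = conic a b c f g h"
proof (induction p rule: poly_mapping_monom_induct)
  case zero
  show ?case by (intro exI[of _ 0]) (simp add: conic_def)
next
  case (add p q)
  then show ?case using conic_add by metis
next
  case (single m)
  with assms have "m \<in> hmons {1..3} (Suc (Suc 0))" by (auto simp: numeral_2_eq_2)
  then obtain i m' where i: "i \<in> {1..3}" "m' \<in> hmons {1..3} (Suc 0)" "m = Poly_Mapping.single i 1 + m'"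
    by (rule hmons_SucE)
  from i(2) obtain j where j: "j \<in> {1..3}" "m' = Poly_Mapping.single j 1"
    by (auto elim!: hmons_SucE simp: hmons_0)
  define k where "k = Poly_Mapping.lookup p m"
  have s: "Poly_Mapping.single m k = Const k * (Var i * Var j)"
    by (simp add: i j Const_def Var_def mult_single)
  have d: "(i = 1 \<or> i = 2 \<or> i = 3) \<and> (j = 1 \<or> j = 2 \<or> j = 3)" using i j by auto
  have "Const k * (Var i * Var j) = conic (if i = 1 \<and> j = 1 then k else 0)
      (if i = 2 \<and> j = 2 then k else 0) (if i = 3 \<and> j = 3 then k else 0)
      (if {i, j} = {2, 3} then k else 0) (if {i, j} = {1, 3} then k else 0)
      (if {i, j} = {1, 2} then k else 0)"
    using d by (elim conjE disjE) (simp_all add: conic_def doubleton_eq_iff mult.commute)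
  then show ?case unfolding k_def[symmetric] s by blast
qed

text \<open>The determinant of \<open>p + k q\<close> is a polynomial in \<open>k\<close> whose
  cubic coefficient is the determinant of \<open>q\<close>. Either \<open>q\<close> is singular, or
  this polynomial is nonconstant and has a root.\<close>

lemma pencil_reducible_member:
  assumes "Poly_Mapping.keys p \<subseteq> hmons {1..3} 2" "Poly_Mapping.keys q \<subseteq> hmons {1..3} 2"
  shows "\<exists>l m. Poly_Mapping.keys l \<subseteq> hmons {1..3} 1 \<and> Poly_Mapping.keys m \<subseteq> hmons {1..3} 1 \<and>
    (q = l * m \<or> (\<exists>k. p + Const k * q = l * m))"
proof -
  from assms obtain a b c f g h a' b' c' f' g' h' where
    p: "p = conic a b c f g h" and q: "q = conic a' b' c' f' g' h'"
    using quadric_is_conic by metis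
  show ?thesis
  proof (cases "4 * a' * b' * c' + f' * g' * h' - a' * f'\<^sup>2 - b' * g'\<^sup>2 - c' * h'\<^sup>2 = 0")
    case True
    from singular_conic_reducible[OF this] show ?thesis unfolding q by blast
  next
    case False
    define P where "P = [:4:] * [:a, a':] * [:b, b':] * [:c, c':] + [:f, f':] * [:g, g':] * [:h, h':]
      - [:a, a':] * [:f, f':]\<^sup>2 - [:b, b':] * [:g, g':]\<^sup>2 - [:c, c':] * [:h, h':]\<^sup>2"
    have "coeff P 3 = 4 * a' * b' * c' + f' * g' * h' - a' * f'\<^sup>2 - b' * g'\<^sup>2 - c' * h'\<^sup>2"
      by (simp add: P_def power2_eq_square eval_nat_numeral algebra_simps)
    with False have "coeff P 3 \<noteq> 0" by simp
    then have "degree P \<noteq> 0" using le_degree by fastforce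
    then obtain k where "poly P k = 0"
      using fundamental_theorem_of_algebra[of P] constant_degree[of P] by auto
    then have k: "poly P k = 0" .
    have "4 * (a + k * a') * (b + k * b') * (c + k * c') + (f + k * f') * (g + k * g') * (h + k * h')
      - (a + k * a') * (f + k * f')\<^sup>2 - (b + k * b') * (g + k * g')\<^sup>2 - (c + k * c') * (h + k * h')\<^sup>2 = poly P k"
      unfolding P_def
      by (simp only: poly_add poly_mult poly_diff poly_power poly_pCons poly_0 mult_zero_right add_0_right)
    also note k
    finally have "4 * (a + k * a') * (b + k * b') * (c + k * c') + (f + k * f') * (g + k * g') * (h + k * h')
      - (a + k * a') * (f + k * f')\<^sup>2 - (b + k * b') * (g + k * g')\<^sup>2 - (c + k * c') * (h + k * h')\<^sup>2 = 0" .
    from singular_conic_reducible[OF this] show ?thesis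
      unfolding p q Const_times_conic conic_add by blast
  qed
qed

subsection \<open>Complete intersections of two quadrics on a reducible surface\<close>

text \<open>Up to a nonzero constant \<open>l\<close> is \<open>Var i - s\<close> for a variable
  \<open>Var i\<close> occurring in it, with \<open>s\<close> free of that variable.\<close>

lemma linear_form_prime:
  fixes l f g :: mpoly
  assumes l: "Poly_Mapping.keys l \<subseteq> hmons W 1" "l \<noteq> 0" and dvd: "l dvd f * g"
  shows "l dvd f \<or> l dvd g"
proof -
  from l(2) obtain m where "m \<in> Poly_Mapping.keys l" by fastforce
  moreover from this l(1) obtain i where "m = Poly_Mapping.single i 1"
    unfolding hmons_1 by blast
  ultimately have i: "Poly_Mapping.single i 1 \<in> Poly_Mapping.keys l" by simp
  define c where "c = Poly_Mapping.lookup l (Poly_Mapping.single i 1)"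
  have c: "c \<noteq> 0" using i by (simp add: c_def in_keys_iff)
  define s where "s = Var i - Const (inverse c) * l"
  have l_eq: "l = Const c * (Var i - s)"
    using Const_inverse[OF c] by (simp add: s_def mult.assoc[symmetric])
  have l_eq': "Var i - s = Const (inverse c) * l" by (simp add: s_def)
  have s0: "Poly_Mapping.lookup s (Poly_Mapping.single i 1) = 0"
    using c unfolding c_def by (simp add: s_def lookup_minus Var_def c_def)
  have ks: "Poly_Mapping.keys s \<subseteq> hmons (insert i W) 1"
    unfolding s_def
    by (intro keys_minus_subset keys_Const_times_subset keys_Var_hmons order_trans[OF l(1)] hmons_mono) auto
  have "subst (Var(i := s)) s = s"
  proof (rule subst_ident)
    fix m v assume m: "m \<in> Poly_Mapping.keys s" and v: "v \<in> Poly_Mapping.keys m"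
    from m ks obtain j where j: "m = Poly_Mapping.single j 1" unfolding hmons_1 by blast
    with m s0 have "j \<noteq> i" by (auto simp: in_keys_iff)
    with v show "(Var(i := s)) v = Var v" by (simp add: j)
  qed
  moreover have "Var i - s dvd f * g"
    using dvd unfolding l_eq by (rule dvd_mult_right)
  ultimately have "Var i - s dvd f \<or> Var i - s dvd g" by (rule Var_minus_prime)
  moreover have "l dvd u" if "Var i - s dvd u" for u
  proof -
    from that obtain w where w: "u = (Var i - s) * w" by (rule dvdE)
    have "u = (Const c * Const (inverse c)) * u" using Const_inverse[OF c] by simp
    also have "\<dots> = l * (Const (inverse c) * w)" by (simp add: w l_eq mult_ac)
    finally show ?thesis by (rule dvdI)
  qed
  ultimately show ?thesis by blast
qed

lemma split_plane:
  assumes "Poly_Mapping.keys p \<subseteq> hmons {..3} (Suc k)"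
  shows "\<exists>a b. Poly_Mapping.keys a \<subseteq> hmons {1..3} (Suc k) \<and> Poly_Mapping.keys b \<subseteq> hmons {..3} k \<and>
    p = a + Var 0 * b"
proof (induction p rule: poly_mapping_monom_induct)
  case zero
  show ?case by (intro exI[of _ 0]) simp
next
  case (add p q)
  then obtain a b a' b' where
    "Poly_Mapping.keys a \<subseteq> hmons {1..3} (Suc k)" "Poly_Mapping.keys b \<subseteq> hmons {..3} k" "p = a + Var 0 * b"
    "Poly_Mapping.keys a' \<subseteq> hmons {1..3} (Suc k)" "Poly_Mapping.keys b' \<subseteq> hmons {..3} k" "q = a' + Var 0 * b'"
    by blast
  then show ?case
    by (intro exI[of _ "a + a'"] exI[of _ "b + b'"]) (simp add: keys_plus_subset algebra_simps)
next
  case (single m)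
  define c where "c = Poly_Mapping.lookup p m"
  from single assms have m: "m \<in> hmons {..3} (Suc k)" by blast
  show ?case unfolding c_def[symmetric]
  proof (cases "0 \<in> Poly_Mapping.keys m")
    case True
    with m obtain m' where m': "m' \<in> hmons {..3} k" "m = Poly_Mapping.single 0 1 + m'"
      by (rule hmons_minus_single)
    moreover from this have "Poly_Mapping.single m c = Var 0 * Poly_Mapping.single m' c"
      by (simp add: Var_def mult_single)
    ultimately show "\<exists>a b. Poly_Mapping.keys a \<subseteq> hmons {1..3} (Suc k) \<and> Poly_Mapping.keys b \<subseteq> hmons {..3} k \<and>
        Poly_Mapping.single m c = a + Var 0 * b"
      by (intro exI[of _ 0] exI[of _ "Poly_Mapping.single m' c"]) simp
  next
    case False
    have "{..3::nat} - {0} = {1..3}" by auto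
    with False m have "m \<in> hmons {1..3} (Suc k)" by (auto simp: hmons_def)
    then show "\<exists>a b. Poly_Mapping.keys a \<subseteq> hmons {1..3} (Suc k) \<and> Poly_Mapping.keys b \<subseteq> hmons {..3} k \<and>
        Poly_Mapping.single m c = a + Var 0 * b"
      by (intro exI[of _ "Poly_Mapping.single m c"] exI[of _ 0]) simp
  qed
qed

lemma subst_plane_ident:
  assumes "Poly_Mapping.keys a \<subseteq> hmons {1..3} k"
  shows "subst (Var(0 := 0)) a = a"
  by (rule subst_ident) (use assms in \<open>fastforce simp: hmons_def\<close>)

lemma subst_plane_decomp: "\<exists>g'. g = subst (Var(0 := 0)) g + Var 0 * g'"
proof -
  have "Var 0 dvd g - subst (Var(0 := 0)) g" by (rule dvd_diff_subst) auto
  then obtain g' where "g - subst (Var(0 := 0)) g = Var 0 * g'" by (rule dvdE)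
  then show ?thesis by (intro exI[of _ g']) (simp add: algebra_simps)
qed

text \<open>Up to degenerations, the next three predicates say that the surface \<open>A = 0\<close> contains a plane
  conic, a twisted cubic (cut out by the minors of a matrix of linear forms), or a complete
  intersection of two quadrics.\<close>

definition on_conic :: "mpoly \<Rightarrow> bool" where
  "on_conic A \<longleftrightarrow> (\<exists>n q g h. Poly_Mapping.keys n \<subseteq> hmons {..3} 1 \<and> n \<noteq> 0 \<and>
     Poly_Mapping.keys q \<subseteq> hmons {..3} 2 \<and> A = n * g + q * h)"

definition on_cubic :: "mpoly \<Rightarrow> bool" where
  "on_cubic A \<longleftrightarrow> (\<exists>l m m' n n' g g' h. Poly_Mapping.keys l \<subseteq> hmons {1..3} 1 \<and> l \<noteq> 0 \<and>
     Poly_Mapping.keys m \<subseteq> hmons {1..3} 1 \<and> m \<noteq> 0 \<and> Poly_Mapping.keys m' \<subseteq> hmons {1..3} 1 \<and> \<not> m dvd m' \<and>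
     Poly_Mapping.keys n \<subseteq> hmons {..3} 1 \<and> Poly_Mapping.keys n' \<subseteq> hmons {..3} 1 \<and>
     A = (l * m + Var 0 * n) * g + (l * m' + Var 0 * n') * g' + (m * n' - m' * n) * h)"

definition on_quartic :: "mpoly \<Rightarrow> bool" where
  "on_quartic A \<longleftrightarrow> (\<exists>l m n q g g'. Poly_Mapping.keys l \<subseteq> hmons {1..3} 1 \<and> l \<noteq> 0 \<and>
     Poly_Mapping.keys m \<subseteq> hmons {1..3} 1 \<and> m \<noteq> 0 \<and> Poly_Mapping.keys n \<subseteq> hmons {..3} 1 \<and>
     Poly_Mapping.keys q \<subseteq> hmons {..3} 2 \<and> A = (l * m + Var 0 * n) * g + q * g')"

text \<open>One quadric is the union of the plane \<open>x\<^sub>0 = 0\<close> and the plane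
  \<open>n = 0\<close>; the residual curve is the conic \<open>n = p = 0\<close>. As
  \<open>Var 0\<close> is prime and does not divide \<open>p\<close>, it divides \<open>h\<close>
  and cancels.\<close>

lemma on_conic_if_quadric_contains_plane:
  assumes eq: "Var 0 * A = (Var 0 * n) * g + p * h" and p: "p = a + Var 0 * n'"
    and a: "Poly_Mapping.keys a \<subseteq> hmons {1..3} 2" and n: "Poly_Mapping.keys n \<subseteq> hmons {..3} 1"
    and n': "Poly_Mapping.keys n' \<subseteq> hmons {..3} 1"
    and unit: "\<And>w. w dvd Var 0 * n \<Longrightarrow> w dvd p \<Longrightarrow> w dvd 1"
  shows "on_conic A"
proof -
  have x0n': "Poly_Mapping.keys (Var 0 * n') \<subseteq> hmons {..3} 2"
    by (intro keys_mult_linear keys_Var_hmons n') simp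
  have "Poly_Mapping.keys a \<subseteq> hmons {..3} 2"
    using a hmons_mono[of "{1..3}" "{..3}" 2] by auto
  then have kp: "Poly_Mapping.keys p \<subseteq> hmons {..3} 2"
    unfolding p using x0n' by (rule keys_plus_subset)
  have "\<not> Var 0 dvd p"
  proof
    assume "Var 0 dvd p"
    then have "Var 0 dvd (1::mpoly)" using unit by simp
    with not_dvd_1[OF keys_Var_hmons[of 0 UNIV]] show False by simp
  qed
  moreover have "p * h = Var 0 * (A - n * g)" using eq by (simp add: algebra_simps)
  then have "Var 0 dvd p * h" by simp
  ultimately have "Var 0 dvd h" using Var_prime by blast
  then obtain h' where h': "h = Var 0 * h'" by (rule dvdE)
  have "Var 0 * A = Var 0 * (n * g + p * h')" using eq by (simp add: h' algebra_simps)
  then have A: "A = n * g + p * h'" by simp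
  have "n \<noteq> 0"
  proof
    assume "n = 0"
    then have "p dvd 1" using unit by simp
    with not_dvd_1[OF kp] show False by simp
  qed
  with A n kp show ?thesis unfolding on_conic_def by blast
qed

text \<open>Both traces contain the line \<open>l = 0\<close>: they are \<open>l m\<close> and
  \<open>l m2\<close>. If \<open>m\<close> divides \<open>m2\<close>, a combination of the quadrics
  contains the plane and the conic case applies. Otherwise the curve residual to the line is cut out
  by the maximal minors of the matrix with rows \<open>(m, m2, -x\<^sub>0)\<close> and
  \<open>(n1, n2, l)\<close>; the minor not among the quadrics comes from
  \<open>m p2 - m2 p1 = x\<^sub>0 (m n2 - m2 n1)\<close>.\<close>

lemma quadric_with_reducible_trace_common_line:
  assumes eq: "Var 0 * A = p1 * g1 + p2 * g2"
    and p1: "p1 = l * m + Var 0 * n1" and p2: "p2 = a2 + Var 0 * n2"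
    and l: "Poly_Mapping.keys l \<subseteq> hmons {1..3} 1" "l \<noteq> 0"
    and m: "Poly_Mapping.keys m \<subseteq> hmons {1..3} 1" "m \<noteq> 0"
    and a2: "Poly_Mapping.keys a2 \<subseteq> hmons {1..3} 2"
    and n1: "Poly_Mapping.keys n1 \<subseteq> hmons {..3} 1" and n2: "Poly_Mapping.keys n2 \<subseteq> hmons {..3} 1"
    and unit: "\<And>w. w dvd p1 \<Longrightarrow> w dvd p2 \<Longrightarrow> w dvd 1"
    and "l dvd a2"
  shows "on_conic A \<or> on_cubic A"
proof -
  let ?b = "subst (Var(0 := 0))"
  from \<open>l dvd a2\<close> obtain m2' where "a2 = l * m2'" by (rule dvdE)
  then have m2': "a2 = m2' * l" by (simp only: mult.commute)
  define m2 where "m2 = part (hmons {1..3} 1) m2'"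
  have "part (hmons {1..3} (1 + 1)) (m2' * l) = m2 * l"
    unfolding m2_def by (rule part_mult[OF l(1)])
  then have a2_eq: "a2 = l * m2"
    unfolding one_add_one m2'[symmetric] part_ident[OF a2] by (simp add: mult.commute)
  have km2: "Poly_Mapping.keys m2 \<subseteq> hmons {1..3} 1" unfolding m2_def by (rule keys_part)
  have klm: "Poly_Mapping.keys (l * m) \<subseteq> hmons {1..3} 2"
    by (rule keys_mult_linear[OF l(1) m(1)])
  show ?thesis
  proof (cases "m dvd m2")
    case True
    then obtain c' where "m2 = m * c'" by (rule dvdE)
    then have c': "m2 = c' * m" by (simp only: mult.commute)
    have "part (hmons {1..3} (0 + 1)) (c' * m) = part (hmons {1..3} 0) c' * m"
      by (rule part_mult[OF m(1)])
    then have "m2 = part (hmons {1..3} 0) c' * m"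
      unfolding add_0 c'[symmetric] part_ident[OF km2] .
    moreover have "part (hmons {1..3} 0) c' = Const (Poly_Mapping.lookup c' 0)"
      by (rule poly_mapping_eqI) (auto simp: lookup_part hmons_0 Const_def lookup_single when_def)
    ultimately have "m2 = Const (Poly_Mapping.lookup c' 0) * m" by (simp only:)
    then obtain c where c: "m2 = Const c * m" by blast
    have p2': "p2 - Const c * p1 = Var 0 * (n2 - Const c * n1)"
      by (simp add: p1 p2 a2_eq c algebra_simps)
    have "on_conic A"
    proof (rule on_conic_if_quadric_contains_plane[OF _ p1 klm _ n1])
      show "Var 0 * A = Var 0 * (n2 - Const c * n1) * g2 + p1 * (g1 + Const c * g2)"
        unfolding p2'[symmetric] eq by (simp add: algebra_simps)
      show "Poly_Mapping.keys (n2 - Const c * n1) \<subseteq> hmons {..3} 1"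
        by (intro keys_minus_subset keys_Const_times_subset n1 n2)
      fix w assume w: "w dvd Var 0 * (n2 - Const c * n1)" "w dvd p1"
      have "w dvd (p2 - Const c * p1) + Const c * p1" unfolding p2'
        by (rule dvd_add[OF w(1) dvd_mult[OF w(2)]])
      then have "w dvd p2" by simp
      with w(2) show "w dvd 1" by (rule unit)
    qed
    then show ?thesis ..
  next
    case False
    obtain g1' where g1': "g1 = ?b g1 + Var 0 * g1'" using subst_plane_decomp by blast
    obtain g2' where g2': "g2 = ?b g2 + Var 0 * g2'" using subst_plane_decomp by blast
    \<comment> \<open>Restrict to the plane and cancel \<open>l\<close>. Since the prime
      \<open>m\<close> does not divide \<open>m2\<close>, the restricted cofactors are
      \<open>h\<close> times the syzygy \<open>(- m2, m)\<close>.\<close>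
    have "?b (Var 0 * A) = ?b (p1 * g1 + p2 * g2)" by (simp add: eq)
    then have "l * (m * ?b g1 + m2 * ?b g2) = 0"
      by (simp add: p1 p2 a2_eq subst_plane_ident[OF l(1)] subst_plane_ident[OF m(1)]
          subst_plane_ident[OF km2] algebra_simps)
    then have z: "m * ?b g1 + m2 * ?b g2 = 0" using l(2) by simp
    then have "m2 * ?b g2 = m * (- ?b g1)" by (simp add: add_eq_0_iff)
    then have "m dvd m2 * ?b g2" by simp
    with False have "m dvd ?b g2" using linear_form_prime[OF m] by blast
    then obtain h where h: "?b g2 = m * h" by (rule dvdE)
    with z have "m * (?b g1 + m2 * h) = 0" by (simp add: algebra_simps)
    then have "?b g1 + m2 * h = 0" using m(2) by simp
    then have h1: "?b g1 = - (m2 * h)" by (simp add: eq_neg_iff_add_eq_0)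
    have g1: "g1 = - (m2 * h) + Var 0 * g1'" using g1' unfolding h1 .
    have g2: "g2 = m * h + Var 0 * g2'" using g2' unfolding h .
    have "Var 0 * A = p1 * (- (m2 * h) + Var 0 * g1') + p2 * (m * h + Var 0 * g2')"
      using eq unfolding g1 g2 .
    also have "\<dots> = Var 0 * (p1 * g1' + p2 * g2' + (m * n2 - m2 * n1) * h)"
      by (simp add: p1 p2 a2_eq algebra_simps)
    finally have "A = p1 * g1' + p2 * g2' + (m * n2 - m2 * n1) * h" by simp
    then have "on_cubic A"
      unfolding on_cubic_def p1 p2 a2_eq
      by - (rule exI[of _ l], rule exI[of _ m], rule exI[of _ m2], rule exI[of _ n1], rule exI[of _ n2], rule exI[of _ g1'], rule exI[of _ g2'], rule exI[of _ h],
          intro conjI l m km2 False n1 n2; assumption)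
    then show ?thesis ..
  qed
qed

text \<open>In the main case the traces have no common factor, so on the plane the restricted
  cofactors are a multiple of the trivial syzygy \<open>(- a2, l m)\<close>. Hence
  \<open>Var 0\<close> cancels modulo the two quadrics and \<open>A\<close> itself lies in their
  ideal.\<close>

lemma quadric_with_reducible_trace:
  assumes eq: "Var 0 * A = p1 * g1 + p2 * g2"
    and p1: "p1 = l * m + Var 0 * n1" and p2: "p2 = a2 + Var 0 * n2"
    and l: "Poly_Mapping.keys l \<subseteq> hmons {1..3} 1"
    and m: "Poly_Mapping.keys m \<subseteq> hmons {1..3} 1"
    and a2: "Poly_Mapping.keys a2 \<subseteq> hmons {1..3} 2"
    and n1: "Poly_Mapping.keys n1 \<subseteq> hmons {..3} 1" and n2: "Poly_Mapping.keys n2 \<subseteq> hmons {..3} 1"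
    and unit: "\<And>w. w dvd p1 \<Longrightarrow> w dvd p2 \<Longrightarrow> w dvd 1"
  shows "on_conic A \<or> on_cubic A \<or> on_quartic A"
proof -
  let ?b = "subst (Var(0 := 0))"
  consider "l * m = 0" | "l \<noteq> 0" "m \<noteq> 0" "l dvd a2" | "l \<noteq> 0" "m \<noteq> 0" "m dvd a2"
    | "l \<noteq> 0" "m \<noteq> 0" "\<not> l dvd a2" "\<not> m dvd a2" by fastforce
  then show ?thesis
  proof cases
    case 1
    then have p1': "p1 = Var 0 * n1" by (simp add: p1)
    from on_conic_if_quadric_contains_plane[OF eq[unfolded p1'] p2 a2 n1 n2] unit
    show ?thesis unfolding p1' by blast
  next
    case 2
    from quadric_with_reducible_trace_common_line[OF eq p1 p2 l 2(1) m 2(2) a2 n1 n2 unit 2(3)]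
    show ?thesis by blast
  next
    case 3
    have p1': "p1 = m * l + Var 0 * n1" by (simp add: p1 mult.commute)
    from quadric_with_reducible_trace_common_line[OF eq p1' p2 m 3(2) l 3(1) a2 n1 n2 unit 3(3)]
    show ?thesis by blast
  next
    case 4
    obtain g1' where g1': "g1 = ?b g1 + Var 0 * g1'" using subst_plane_decomp by blast
    obtain g2' where g2': "g2 = ?b g2 + Var 0 * g2'" using subst_plane_decomp by blast
    have "?b (Var 0 * A) = ?b (p1 * g1 + p2 * g2)" by (simp add: eq)
    then have z: "l * m * ?b g1 + a2 * ?b g2 = 0"
      by (simp add: p1 p2 subst_plane_ident[OF l] subst_plane_ident[OF m] subst_plane_ident[OF a2])
    then have "a2 * ?b g2 = l * (- (m * ?b g1))" by (simp add: add_eq_0_iff mult.assoc)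
    then have "l dvd a2 * ?b g2" by simp
    with 4 have "l dvd ?b g2" using linear_form_prime[OF l] by blast
    then obtain h' where h': "?b g2 = l * h'" by (rule dvdE)
    \<comment> \<open>The forms \<open>l\<close> and \<open>m\<close> may be proportional, so the
      factors of \<open>l m\<close> are cancelled one at a time.\<close>
    with z have "l * (m * ?b g1 + a2 * h') = 0" by (simp add: algebra_simps)
    then have z': "m * ?b g1 + a2 * h' = 0" using 4 by simp
    then have "a2 * h' = m * (- ?b g1)" by (simp add: add_eq_0_iff)
    then have "m dvd a2 * h'" by simp
    with 4 have "m dvd h'" using linear_form_prime[OF m] by blast
    then obtain h where h: "h' = m * h" by (rule dvdE)
    with z' have "m * (?b g1 + a2 * h) = 0" by (simp add: algebra_simps)
    then have "?b g1 + a2 * h = 0" using 4 by simp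
    then have h1: "?b g1 = - (a2 * h)" by (simp add: eq_neg_iff_add_eq_0)
    have g1: "g1 = - (a2 * h) + Var 0 * g1'" using g1' unfolding h1 .
    have g2: "g2 = l * m * h + Var 0 * g2'" using g2' unfolding h' h mult.assoc .
    have "Var 0 * A = p1 * (- (a2 * h) + Var 0 * g1') + p2 * (l * m * h + Var 0 * g2')"
      using eq unfolding g1 g2 .
    also have "\<dots> = Var 0 * (p1 * (g1' + n2 * h) + p2 * (g2' - n1 * h))"
      by (simp add: p1 p2 algebra_simps)
    finally have A: "A = p1 * (g1' + n2 * h) + p2 * (g2' - n1 * h)" by simp
    have "Poly_Mapping.keys (Var 0 * n2) \<subseteq> hmons {..3} 2"
      by (intro keys_mult_linear keys_Var_hmons n2) simp
    moreover have "Poly_Mapping.keys a2 \<subseteq> hmons {..3} 2"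
      using a2 hmons_mono[of "{1..3}" "{..3}" 2] by auto
    ultimately have "Poly_Mapping.keys p2 \<subseteq> hmons {..3} 2"
      unfolding p2 by (intro keys_plus_subset)
    with A have "on_quartic A"
      unfolding on_quartic_def p1
      by - (rule exI[of _ l], rule exI[of _ m], rule exI[of _ n1], rule exI[of _ p2], rule exI[of _ "g1' + n2 * h"], rule exI[of _ "g2' - n1 * h"],
          intro conjI l m 4 n1; assumption)
    then show ?thesis by blast
  qed
qed

lemma plane_times_in_Fset_2_2:
  assumes "Var 0 * A \<in> Fset [2,2] 3 d"
  shows "on_conic A \<or> on_cubic A \<or> on_quartic A"
proof -
  from assms obtain p q g h where pq: "Poly_Mapping.keys p \<subseteq> hmons {..3} 2"
    "Poly_Mapping.keys q \<subseteq> hmons {..3} 2" and reg: "regular_seq [p, q]"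
    and eq: "Var 0 * A = p * g + q * h"
    unfolding Fset_pair hom_poly_hmons by blast
  \<comment> \<open>A regular pair has no common factor: with \<open>p = w a\<close> and
    \<open>q = w b\<close>, \<open>p\<close> divides \<open>a q\<close>, hence \<open>a\<close>, and
    cancelling \<open>a\<close> inverts \<open>w\<close>.\<close>
  have unit: "w dvd 1" if "w dvd p" "w dvd q" for w
  proof -
    from that(1) obtain a where a: "p = w * a" by (rule dvdE)
    from that(2) obtain b where b: "q = w * b" by (rule dvdE)
    have "p dvd a * q" by (simp add: a b)
    then have "p dvd a" using reg unfolding regular_seq_pair by blast
    then obtain c where "a = w * a * c" unfolding a by (rule dvdE)
    then have "a * (w * c - 1) = 0" by (simp add: algebra_simps)
    moreover have "p \<noteq> 0" using reg unfolding regular_seq_pair by blast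
    then have "a \<noteq> 0" by (auto simp: a)
    ultimately have "1 = w * c" by simp
    then show ?thesis by (rule dvdI)
  qed
  note split = split_plane[where k = 1, unfolded Suc_1]
  from split[OF pq(1)] obtain a n where a: "Poly_Mapping.keys a \<subseteq> hmons {1..3} 2"
    "Poly_Mapping.keys n \<subseteq> hmons {..3} 1" "p = a + Var 0 * n" by blast
  from split[OF pq(2)] obtain a' n' where a': "Poly_Mapping.keys a' \<subseteq> hmons {1..3} 2"
    "Poly_Mapping.keys n' \<subseteq> hmons {..3} 1" "q = a' + Var 0 * n'" by blast
  from pencil_reducible_member[OF a(1) a'(1)] obtain l m where
    lm: "Poly_Mapping.keys l \<subseteq> hmons {1..3} 1" "Poly_Mapping.keys m \<subseteq> hmons {1..3} 1"
    and "a' = l * m \<or> (\<exists>k. a + Const k * a' = l * m)" by blast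
  then consider "a' = l * m" | k where "a + Const k * a' = l * m" by blast
  then show ?thesis
  proof cases
    case 1
    have "Var 0 * A = q * h + p * g" using eq by (simp add: add.commute)
    from quadric_with_reducible_trace[OF this a'(3)[unfolded 1] a(3) lm a(1) a'(2) a(2)] unit
    show ?thesis by blast
  next
    case 2
    \<comment> \<open>The generator \<open>p\<close> is exchanged for the pencil member with
      reducible trace; the ideal stays the same.\<close>
    have eq': "Var 0 * A = (p + Const k * q) * g + q * (h - Const k * g)"
      using eq by (simp add: algebra_simps)
    have p': "p + Const k * q = l * m + Var 0 * (n + Const k * n')"
      unfolding 2[symmetric] by (simp add: a(3) a'(3) algebra_simps)
    have n'': "Poly_Mapping.keys (n + Const k * n') \<subseteq> hmons {..3} 1"
      by (intro keys_plus_subset keys_Const_times_subset a a')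
    have unit': "w dvd 1" if "w dvd p + Const k * q" "w dvd q" for w
    proof -
      have "w dvd p + Const k * q - Const k * q"
        by (rule dvd_diff[OF that(1) dvd_mult[OF that(2)]])
      then show ?thesis using unit that(2) by simp
    qed
    show ?thesis
      by (rule quadric_with_reducible_trace[OF eq' p' a'(3) lm a'(1) n'' a'(2) unit'])
  qed
qed

subsection \<open>Counting monomials\<close>

lemma finite_hmons [simp]: "finite W \<Longrightarrow> finite (hmons W k)"
proof (induction k)
  case 0
  show ?case by (simp add: hmons_0)
next
  case (Suc k)
  have "hmons W (Suc k) \<subseteq> (\<lambda>(i, m). Poly_Mapping.single i 1 + m) ` (W \<times> hmons W k)"
    by (auto elim!: hmons_SucE)
  then show ?case using Suc by (meson finite_SigmaI finite_imageI finite_subset)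
qed

text \<open>Pascal's recursion: a monomial either contains the variable \<open>w\<close>, which can
  be split off, or is a monomial in \<open>W\<close>.\<close>

lemma card_hmons_insert:
  assumes "finite W" "w \<notin> W"
  shows "card (hmons (insert w W) (Suc k)) = card (hmons (insert w W) k) + card (hmons W (Suc k))"
proof -
  let ?f = "\<lambda>m. Poly_Mapping.single w 1 + m :: nat \<Rightarrow>\<^sub>0 nat"
  have "hmons (insert w W) (Suc k) = ?f ` hmons (insert w W) k \<union> hmons W (Suc k)"
  proof (intro equalityI subsetI)
    fix m assume m: "m \<in> hmons (insert w W) (Suc k)"
    show "m \<in> ?f ` hmons (insert w W) k \<union> hmons W (Suc k)"
    proof (cases "w \<in> Poly_Mapping.keys m")
      case True
      from hmons_minus_single[OF m this] show ?thesis by blast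
    next
      case False
      with m have "m \<in> hmons W (Suc k)" by (auto simp: hmons_def)
      then show ?thesis ..
    qed
  next
    fix m assume "m \<in> ?f ` hmons (insert w W) k \<union> hmons W (Suc k)"
    then show "m \<in> hmons (insert w W) (Suc k)"
      by (auto simp: hmons_def mon_deg_add keys_add_nat)
  qed
  moreover have "?f ` hmons (insert w W) k \<inter> hmons W (Suc k) = {}"
    using assms by (auto simp: hmons_def keys_add_nat)
  moreover have "inj_on ?f (hmons (insert w W) k)" by (simp add: inj_on_def)
  ultimately show ?thesis using assms by (simp add: card_Un_disjoint card_image)
qed

lemma card_hmons:
  assumes "finite W" "card W = Suc n"
  shows "card (hmons W k) = (k + n) choose n"
  using assms
proof (induction n arbitrary: W k)
  case 0
  then obtain w where W: "W = {w}" by (auto simp: card_Suc_eq)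
  have e: "hmons {} (Suc j) = {}" for j by (auto simp: hmons_def)
  show ?case unfolding W
    by (induction k) (simp_all add: hmons_0 card_hmons_insert e)
next
  case (Suc n)
  then have "W \<noteq> {}" by auto
  then obtain w where w: "w \<in> W" by auto
  define V where "V = W - {w}"
  have W: "W = insert w V" "w \<notin> V" "card V = Suc n" "finite V"
    using w Suc.prems by (auto simp: V_def)
  note IH = Suc.IH[OF W(4,3)]
  show ?case unfolding W(1)
  proof (induction k)
    case 0
    show ?case by (simp add: hmons_0)
  next
    case (Suc k)
    then show ?case using IH[of "Suc k"] W by (simp add: card_hmons_insert)
  qed
qed

text \<open>The monomials that may occur in a remainder of degree \<open>k\<close> after division by
  a form with leading monomial \<open>\<mu>\<close>.\<close>

definition nondiv :: "nat set \<Rightarrow> nat \<Rightarrow> (nat \<Rightarrow>\<^sub>0 nat) \<Rightarrow> (nat \<Rightarrow>\<^sub>0 nat) set" where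
  "nondiv W k \<mu> = {m \<in> hmons W k. \<forall>m'. m \<noteq> \<mu> + m'}"

lemma nondiv_single: "nondiv W (Suc k) (Poly_Mapping.single i 1) \<subseteq> hmons (W - {i}) (Suc k)"
proof
  fix m assume m: "m \<in> nondiv W (Suc k) (Poly_Mapping.single i 1)"
  have "i \<notin> Poly_Mapping.keys m"
  proof
    assume "i \<in> Poly_Mapping.keys m"
    with m show False by (auto simp: nondiv_def elim!: hmons_minus_single)
  qed
  with m show "m \<in> hmons (W - {i}) (Suc k)" by (auto simp: nondiv_def hmons_def)
qed

lemma card_nondiv:
  assumes "finite W" "\<mu> \<in> hmons W j"
  shows "card (nondiv W (k + j) \<mu>) + card (hmons W k) = card (hmons W (k + j))"
proof -
  let ?f = "\<lambda>m. \<mu> + m"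
  have "hmons W (k + j) = nondiv W (k + j) \<mu> \<union> ?f ` hmons W k"
    using assms(2) by (auto simp: nondiv_def hmons_add_iff add.commute[of \<mu>])
  moreover have "nondiv W (k + j) \<mu> \<inter> ?f ` hmons W k = {}" by (auto simp: nondiv_def)
  moreover have "finite (nondiv W (k + j) \<mu>)" using assms(1) by (simp add: nondiv_def)
  moreover have "inj_on ?f (hmons W k)" by (simp add: inj_on_def)
  ultimately show ?thesis using assms(1) by (simp add: card_Un_disjoint card_image)
qed

subsection \<open>Polynomial families of forms\<close>

definition poly_family :: "'i set \<Rightarrow> (('i \<Rightarrow> complex) \<Rightarrow> mpoly) \<Rightarrow> bool" where
  "poly_family I F \<longleftrightarrow> (\<forall>m. is_poly_fun I (\<lambda>x. Poly_Mapping.lookup (F x) m))"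

lemma finite_add_decompositions: "finite {p. fst p + snd p = (m :: nat \<Rightarrow>\<^sub>0 nat)}"
proof -
  let ?H = "\<Union>k\<le>mon_deg m. hmons (Poly_Mapping.keys m) k"
  have "{p. fst p + snd p = m} \<subseteq> ?H \<times> ?H"
    by (auto simp: hmons_def keys_add_nat mon_deg_add)
  then show ?thesis by (rule finite_subset) simp
qed

text \<open>The index set depends only on \<open>m\<close>, not on the supports of the factors, so
  coefficients of products of polynomial families are visibly polynomial in the parameters.\<close>

lemma lookup_mult_finite_sum:
  fixes f g :: mpoly
  shows "Poly_Mapping.lookup (f * g) m =
    (\<Sum>p\<in>{p. fst p + snd p = m}. Poly_Mapping.lookup f (fst p) * Poly_Mapping.lookup g (snd p))"
proof (induction f rule: poly_mapping_monom_induct)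
  case (single a)
  define c where "c = Poly_Mapping.lookup f a"
  show ?case unfolding c_def[symmetric]
  proof (induction g rule: poly_mapping_monom_induct)
    case (single b)
    define c' where "c' = Poly_Mapping.lookup g b"
    have "(\<Sum>p\<in>{p. fst p + snd p = m}.
        Poly_Mapping.lookup (Poly_Mapping.single a c) (fst p) * Poly_Mapping.lookup (Poly_Mapping.single b c') (snd p))
      = (\<Sum>p\<in>{p. fst p + snd p = m}. if p = (a, b) then c * c' else 0)"
      by (rule sum.cong) (auto simp: lookup_single when_def)
    also have "\<dots> = (if a + b = m then c * c' else 0)"
      using finite_add_decompositions[of m] by (subst sum.delta) auto
    finally show ?case unfolding c'_def[symmetric] by (simp add: mult_single lookup_single when_def)
  qed (simp_all add: distrib_left lookup_add sum.distrib)
qed (simp_all add: distrib_right lookup_add sum.distrib)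

lemma poly_family_const: "finite I \<Longrightarrow> poly_family I (\<lambda>_. f)"
  by (simp add: poly_family_def is_poly_fun_const)

lemma poly_family_add:
  "finite I \<Longrightarrow> poly_family I F \<Longrightarrow> poly_family I G \<Longrightarrow> poly_family I (\<lambda>x. F x + G x)"
  by (simp add: poly_family_def lookup_add is_poly_fun_add)

lemma poly_family_mult:
  "finite I \<Longrightarrow> poly_family I F \<Longrightarrow> poly_family I G \<Longrightarrow> poly_family I (\<lambda>x. F x * G x)"
  unfolding poly_family_def lookup_mult_finite_sum
  by (intro allI is_poly_fun_sum is_poly_fun_mult finite_add_decompositions) simp_all

lemma poly_family_diff:
  assumes "finite I" "poly_family I F" "poly_family I G"
  shows "poly_family I (\<lambda>x. F x - G x)"
proof -
  have "poly_family I (\<lambda>x. F x + Const (- 1) * G x)"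
    by (intro poly_family_add poly_family_mult poly_family_const assms)
  then show ?thesis by (simp add: Const_uminus)
qed

text \<open>The generic form with support in \<open>M\<close>. The tag \<open>j\<close> keeps the
  coefficients of several such forms apart in one parameter space.\<close>

definition slot :: "nat \<Rightarrow> (nat \<Rightarrow>\<^sub>0 nat) set \<Rightarrow> (nat \<times> (nat \<Rightarrow>\<^sub>0 nat) \<Rightarrow> complex) \<Rightarrow> mpoly" where
  "slot j M x = (\<Sum>m\<in>M. Poly_Mapping.single m (x (j, m)))"

lemma lookup_slot:
  "finite M \<Longrightarrow> Poly_Mapping.lookup (slot j M x) m = (if m \<in> M then x (j, m) else 0)"
  by (simp add: slot_def lookup_sum lookup_single when_def sum.delta)

lemma poly_family_slot:
  assumes "finite I" "finite M" "{j} \<times> M \<subseteq> I"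
  shows "poly_family I (slot j M)"
proof -
  have "is_poly_fun I (\<lambda>x. Poly_Mapping.lookup (slot j M x) m)" for m
  proof (cases "m \<in> M")
    case True
    then show ?thesis using assms by (auto simp: lookup_slot intro: is_poly_fun_var)
  next
    case False
    then show ?thesis using assms by (auto simp: lookup_slot intro: is_poly_fun_const)
  qed
  then show ?thesis by (simp add: poly_family_def)
qed

lemma slot_lookup:
  assumes "finite M" "Poly_Mapping.keys (f j) \<subseteq> M"
  shows "slot j M (\<lambda>(j, m). Poly_Mapping.lookup (f j) m) = f j"
  using sum_single_keys[OF assms] by (simp add: slot_def)

text \<open>Each family is a pair of a parameter set and a map. Its coefficients at the monomials of
  \<open>V\<close> form a polynomial map into a space of larger dimension, and differing from its
  values there suffices.\<close>

lemma exists_form_avoiding_families: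
  assumes V: "finite V" and C: "finite C"
    and fam: "\<And>c. c \<in> C \<Longrightarrow> finite (fst c) \<and> card (fst c) < card V \<and> poly_family (fst c) (snd c)"
  shows "\<exists>A. Poly_Mapping.keys A \<subseteq> V \<and> (\<forall>c\<in>C. \<forall>x. A \<noteq> snd c x)"
proof -
  obtain v where v: "bij_betw v {..<card V} V"
    using ex_bij_betw_nat_finite[OF V] by (auto simp: atLeast0LessThan)
  have "\<exists>y. \<forall>c\<in>C. \<forall>x. \<exists>i<card V. Poly_Mapping.lookup (snd c x) (v i) \<noteq> y i"
    by (rule polynomial_images_not_covering[OF C, where I = fst])
      (use fam in \<open>auto simp: poly_family_def\<close>)
  then obtain y where y: "\<And>c x. c \<in> C \<Longrightarrow> \<exists>i<card V. Poly_Mapping.lookup (snd c x) (v i) \<noteq> y i"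
    by auto
  define A where "A = (\<Sum>i<card V. Poly_Mapping.single (v i) (y i))"
  have A: "Poly_Mapping.lookup A (v i) = y i" if "i < card V" for i
  proof -
    have "Poly_Mapping.lookup A (v i) = (\<Sum>j<card V. if j = i then y i else 0)"
      unfolding A_def lookup_sum
      by (rule sum.cong)
        (use v that in \<open>auto simp: lookup_single when_def bij_betw_def inj_on_def\<close>)
    then show ?thesis using that by simp
  qed
  have "Poly_Mapping.keys A \<subseteq> V"
  proof
    fix m assume "m \<in> Poly_Mapping.keys A"
    then have "Poly_Mapping.lookup A m \<noteq> 0" by (simp add: in_keys_iff)
    then obtain i where "i < card V" "Poly_Mapping.lookup (Poly_Mapping.single (v i) (y i)) m \<noteq> 0"
      unfolding A_def lookup_sum by (meson lessThan_iff sum.not_neutral_contains_not_neutral)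
    then have "m = v i" by (auto simp: lookup_single when_def split: if_splits)
    then show "m \<in> V" using v \<open>i < card V\<close> by (auto simp: bij_betw_def)
  qed
  moreover have "A \<noteq> snd c x" if "c \<in> C" for c x
    using y[OF that, of x] A by auto
  ultimately show ?thesis by blast
qed

subsection \<open>Normal forms\<close>

text \<open>The support of the tail of a linear form scaled to be monic in its variable of largest
  index \<open>i\<close>. Counting only this tail removes the scalar from the parameters.\<close>

definition lower :: "nat set \<Rightarrow> nat \<Rightarrow> (nat \<Rightarrow>\<^sub>0 nat) set" where
  "lower W i = (\<lambda>v. Poly_Mapping.single v 1) ` {v \<in> W. v < i}"

lemma lower_subset: "lower W i \<subseteq> hmons W 1"
  unfolding lower_def hmons_1 by auto

lemma finite_lower [simp]: "finite (lower W i)"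
  by (simp add: lower_def)

lemma card_lower: "card (lower W i) \<le> card {v \<in> W. v < i}"
  unfolding lower_def by (rule card_image_le) simp

lemma keys_Var_plus_lower:
  assumes "i \<in> W" "Poly_Mapping.keys r \<subseteq> lower W i"
  shows "Poly_Mapping.keys (Var i + r) \<subseteq> hmons W 1"
  using assms lower_subset by (intro keys_plus_subset keys_Var_hmons) blast+

lemma linear_form_monic:
  fixes l :: mpoly
  assumes W: "finite W" and l: "Poly_Mapping.keys l \<subseteq> hmons W 1" "l \<noteq> 0"
  obtains i c r where "i \<in> W" "c \<noteq> 0" "l = Const c * (Var i + r)" "Poly_Mapping.keys r \<subseteq> lower W i"
proof -
  define S where "S = {v \<in> W. Poly_Mapping.single v 1 \<in> Poly_Mapping.keys l}"
  from l(2) have "Poly_Mapping.keys l \<noteq> {}" by simp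
  then obtain m where m: "m \<in> Poly_Mapping.keys l" by blast
  with l(1) obtain v where "v \<in> W" "m = Poly_Mapping.single v 1" unfolding hmons_1 by blast
  with m have S: "finite S" "S \<noteq> {}" using W by (auto simp: S_def)
  define i where "i = Max S"
  have i: "i \<in> S" and top: "v \<in> S \<Longrightarrow> v \<le> i" for v
    using S by (auto simp: i_def)
  define c where "c = Poly_Mapping.lookup l (Poly_Mapping.single i 1)"
  define r where "r = Const (inverse c) * l - Var i"
  have c: "c \<noteq> 0" using i by (simp add: S_def c_def in_keys_iff)
  have "Const c * (Var i + r) = Const c * Const (inverse c) * l" by (simp add: r_def mult.assoc)
  then have eq: "l = Const c * (Var i + r)" using Const_inverse[OF c] by simp
  have "Poly_Mapping.keys r \<subseteq> lower W i"
  proof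
    fix m assume m: "m \<in> Poly_Mapping.keys r"
    have "Poly_Mapping.lookup r (Poly_Mapping.single i 1) = 0"
      using c unfolding r_def c_def by (simp add: lookup_minus Var_def)
    with m have ne: "m \<noteq> Poly_Mapping.single i 1" by (auto simp: in_keys_iff)
    with m have "m \<in> Poly_Mapping.keys l"
      by (auto simp: r_def in_keys_iff lookup_minus Var_def lookup_single when_def split: if_splits)
    moreover from this l(1) obtain v where v: "v \<in> W" "m = Poly_Mapping.single v 1"
      unfolding hmons_1 by blast
    ultimately have "v \<in> S" by (simp add: S_def)
    with top ne v have "v < i" by (metis le_neq_implies_less)
    with v show "m \<in> lower W i" by (auto simp: lower_def)
  qed
  with i c eq that show ?thesis by (auto simp: S_def)
qed

lemma homogeneous_division:
  fixes f p r :: mpoly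
  assumes f: "Poly_Mapping.keys f \<subseteq> hmons W (k + j)" and p: "Poly_Mapping.keys p \<subseteq> hmons W j"
    and lead: "p = Poly_Mapping.single \<mu> 1 + r" "\<And>m. m \<in> Poly_Mapping.keys r \<Longrightarrow> wt \<omega> m < wt \<omega> \<mu>"
  obtains s q where "f = s * p + q" "Poly_Mapping.keys s \<subseteq> hmons W k"
    "Poly_Mapping.keys q \<subseteq> nondiv W (k + j) \<mu>"
proof -
  from division_by_leading_monomial[OF lead, of f] obtain s q where
    sq: "f = s * p + q" "\<forall>m\<in>Poly_Mapping.keys q. \<forall>m'. m \<noteq> \<mu> + m'" by blast
  let ?P = "part (hmons W (k + j))"
  have "f = ?P f" using f by (simp add: part_ident)
  also have "\<dots> = part (hmons W k) s * p + ?P q"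
    unfolding sq(1) part_add part_mult[OF p] ..
  finally have "f = part (hmons W k) s * p + ?P q" .
  moreover have "Poly_Mapping.keys (?P q) \<subseteq> nondiv W (k + j) \<mu>"
    using sq(2) by (auto simp: nondiv_def in_keys_iff lookup_part split: if_splits)
  ultimately show ?thesis using that keys_part by blast
qed

lemma division_by_monic_linear:
  assumes f: "Poly_Mapping.keys f \<subseteq> hmons W (Suc k)" and i: "i \<in> W" and r: "Poly_Mapping.keys r \<subseteq> lower W i"
  obtains s q where "f = s * (Var i + r) + q" "Poly_Mapping.keys s \<subseteq> hmons W k"
    "Poly_Mapping.keys q \<subseteq> hmons (W - {i}) (Suc k)"
proof -
  \<comment> \<open>Weighting each variable by its index makes \<open>Var i\<close> lead its
    tail.\<close>
  have "wt (\<lambda>v. v) m < wt (\<lambda>v. v) (Poly_Mapping.single i 1)" if "m \<in> Poly_Mapping.keys r" for m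
    using that r by (auto simp: lower_def wt_single)
  moreover have "Poly_Mapping.keys f \<subseteq> hmons W (k + 1)" using f by simp
  ultimately obtain s q where "f = s * (Var i + r) + q" "Poly_Mapping.keys s \<subseteq> hmons W k"
    "Poly_Mapping.keys q \<subseteq> nondiv W (k + 1) (Poly_Mapping.single i 1)"
    using homogeneous_division[OF _ keys_Var_plus_lower[OF i r], where \<mu> = "Poly_Mapping.single i 1" and r = r]
    unfolding Var_def by blast
  with that nondiv_single[of W k i] show ?thesis by auto
qed

text \<open>Two variables among \<open>x\<^sub>1, x\<^sub>2, x\<^sub>3\<close> together outweigh \<open>x\<^sub>0\<close> times any variable, so
  the leading monomial of \<open>l m + x\<^sub>0 n\<close> is that of \<open>l m\<close>.\<close>

definition trace_wt :: "nat \<Rightarrow> nat" where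
  "trace_wt v = (if v = 0 then 0 else 9 + v)"

lemma division_by_quadric_with_reducible_trace:
  assumes f: "Poly_Mapping.keys f \<subseteq> hmons {..3} (k + 2)"
    and i: "i \<in> {1..3}" "j \<in> {1..3}"
    and r: "Poly_Mapping.keys r \<subseteq> lower {1..3} i" "Poly_Mapping.keys r' \<subseteq> lower {1..3} j"
    and n: "Poly_Mapping.keys n \<subseteq> hmons {..3} 1"
  obtains s q where "f = s * ((Var i + r) * (Var j + r') + Var 0 * n) + q" "Poly_Mapping.keys s \<subseteq> hmons {..3} k"
    "Poly_Mapping.keys q \<subseteq> nondiv {..3} (k + 2) (Poly_Mapping.single i 1 + Poly_Mapping.single j 1)"
proof -
  define bnd where "bnd f b \<longleftrightarrow> (\<forall>m\<in>Poly_Mapping.keys f. wt trace_wt m \<le> b)" for f :: mpoly and b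
  have bnd_mult: "bnd (f * g) (b + b')" if "bnd f b" "bnd g b'" for f g b b'
    unfolding bnd_def
  proof
    fix m assume "m \<in> Poly_Mapping.keys (f * g)"
    then obtain a a' where "a \<in> Poly_Mapping.keys f" "a' \<in> Poly_Mapping.keys g" "m = a + a'"
      using keys_mult[of f g] by blast
    with that show "wt trace_wt m \<le> b + b'" by (auto simp: bnd_def wt_add intro!: add_mono)
  qed
  have bnd_add: "bnd (f + g) b" if "bnd f b" "bnd g b" for f g b
    using that Poly_Mapping.keys_add[of f g] unfolding bnd_def by blast
  have bnd_mono: "bnd f b'" if "bnd f b" "b \<le> b'" for f b b'
    using that unfolding bnd_def by (meson order_trans)
  have Vb: "bnd (Var v) (trace_wt v)" for v
    by (simp add: bnd_def keys_Var wt_single)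
  have rb: "bnd r (8 + i)" "bnd r' (8 + j)"
    using r i by (auto simp: bnd_def lower_def wt_single trace_wt_def subset_eq)
  have nb: "bnd n 12"
    using n by (auto simp: bnd_def hmons_1[unfolded One_nat_def] wt_single trace_wt_def subset_eq)
  let ?r = "Var i * r' + r * Var j + r * r' + Var 0 * n"
  have "bnd (Var i * r') (9 + i + (8 + j))" "bnd (r * Var j) (8 + i + (9 + j))"
    "bnd (r * r') (8 + i + (8 + j))" "bnd (Var 0 * n) (0 + 12)"
    using bnd_mult[OF Vb rb(2), of i] bnd_mult[OF rb(1) Vb, of j] bnd_mult[OF rb] bnd_mult[OF Vb nb, of 0] i
    by (simp_all add: trace_wt_def)
  \<comment> \<open>The leading product has weight \<open>18 + i + j\<close>. Lowering a factor to
    its tail loses at least 1, and \<open>Var 0 * n\<close> has weight at most 12, that of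
    \<open>Var 3\<close>.\<close>
  then have "bnd ?r (17 + i + j)" using i by (intro bnd_add) (erule bnd_mono; simp)+
  then have lt: "wt trace_wt m < wt trace_wt (Poly_Mapping.single i 1 + Poly_Mapping.single j 1)"
    if "m \<in> Poly_Mapping.keys ?r" for m
    using that i by (auto simp: bnd_def wt_add wt_single trace_wt_def)
  have eq: "(Var i + r) * (Var j + r') + Var 0 * n
      = Poly_Mapping.single (Poly_Mapping.single i 1 + Poly_Mapping.single j 1) 1 + ?r"
    by (simp add: algebra_simps Var_def mult_single)
  have "{1..3} \<subseteq> {..3::nat}" by auto
  note up = hmons_mono[OF this]
  have "Poly_Mapping.keys (Var i + r) \<subseteq> hmons {..3} 1" "Poly_Mapping.keys (Var j + r') \<subseteq> hmons {..3} 1"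
    using keys_Var_plus_lower[OF i(1) r(1)] keys_Var_plus_lower[OF i(2) r(2)] up by blast+
  then have "Poly_Mapping.keys ((Var i + r) * (Var j + r') + Var 0 * n) \<subseteq> hmons {..3} 2"
    by (rule keys_plus_subset[OF keys_mult_linear keys_mult_linear[OF keys_Var_hmons n]]) simp
  from homogeneous_division[OF f this eq lt] that show ?thesis by blast
qed

subsection \<open>Parameter counts\<close>

definition slots_index :: "(nat \<Rightarrow>\<^sub>0 nat) set list \<Rightarrow> (nat \<times> (nat \<Rightarrow>\<^sub>0 nat)) set" where
  "slots_index Ms = Sigma {..<length Ms} ((!) Ms)"

lemma finite_slots_index: "(\<And>M. M \<in> set Ms \<Longrightarrow> finite M) \<Longrightarrow> finite (slots_index Ms)"
  by (auto simp: slots_index_def)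

lemma card_slots_index:
  assumes "\<And>M. M \<in> set Ms \<Longrightarrow> finite M"
  shows "card (slots_index Ms) = sum_list (map card Ms)"
proof -
  have "card (slots_index Ms) = (\<Sum>j<length Ms. card (Ms ! j))"
    using assms by (simp add: slots_index_def card_SigmaI)
  then show ?thesis by (simp add: sum_list_sum_nth atLeast0LessThan)
qed

lemma poly_family_slots:
  assumes "\<And>M. M \<in> set Ms \<Longrightarrow> finite M" "j < length Ms"
  shows "poly_family (slots_index Ms) (slot j (Ms ! j))"
  using assms by (intro poly_family_slot finite_slots_index) (auto simp: slots_index_def)

lemma slots_represent:
  assumes "list_all2 (\<lambda>f M. finite M \<and> Poly_Mapping.keys f \<subseteq> M) fs Ms"
  shows "\<exists>x. \<forall>j<length Ms. slot j (Ms ! j) x = fs ! j"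
proof (intro exI allI impI)
  fix j assume "j < length Ms"
  then show "slot j (Ms ! j) (\<lambda>(j, m). Poly_Mapping.lookup (fs ! j) m) = fs ! j"
    using assms by (intro slot_lookup) (auto simp: list_all2_conv_all_nth)
qed

text \<open>In order: the tail of the monic plane equation; a conic in the remaining variables,
  scaled to coefficient 1 at \<open>\<kappa>\<close>; the free cofactor of the plane; the cofactor
  of the conic, reduced modulo the plane.\<close>

definition conic_slots :: "nat \<Rightarrow> nat \<Rightarrow> (nat \<Rightarrow>\<^sub>0 nat) \<Rightarrow> (nat \<Rightarrow>\<^sub>0 nat) set list" where
  "conic_slots u i \<kappa> = [lower {..3} i, hmons ({..3} - {i}) 2 - {\<kappa>}, hmons {..3} (u + 3), hmons ({..3} - {i}) (u + 2)]"

definition conic_family :: "nat \<Rightarrow> nat \<Rightarrow> (nat \<Rightarrow>\<^sub>0 nat) \<Rightarrow> (nat \<times> (nat \<Rightarrow>\<^sub>0 nat) \<Rightarrow> complex) \<Rightarrow> mpoly" where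
  "conic_family u i \<kappa> x = (let s = (\<lambda>j. slot j (conic_slots u i \<kappa> ! j) x) in
     (Var i + s 0) * s 2 + (Poly_Mapping.single \<kappa> 1 + s 1) * s 3)"

text \<open>The first three entries describe a quadric with leading monomial \<open>\<mu>\<close>.
  The second quadric and its cofactor are reduced modulo the first. The scalar of the second quadric
  is left in, one parameter too many.\<close>

definition quartic_slots :: "nat \<Rightarrow> nat \<Rightarrow> nat \<Rightarrow> (nat \<Rightarrow>\<^sub>0 nat) set list" where
  "quartic_slots u i j = (let \<mu> = Poly_Mapping.single i 1 + Poly_Mapping.single j 1 in
     [lower {1..3} i, lower {1..3} j, hmons {..3} 1, hmons {..3} 2 - {\<mu>}, hmons {..3} (u + 2),
      nondiv {..3} (u + 2) \<mu>])"

definition quartic_family :: "nat \<Rightarrow> nat \<Rightarrow> nat \<Rightarrow> (nat \<times> (nat \<Rightarrow>\<^sub>0 nat) \<Rightarrow> complex) \<Rightarrow> mpoly" where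
  "quartic_family u i j x = (let s = (\<lambda>k. slot k (quartic_slots u i j ! k) x) in
     ((Var i + s 0) * (Var j + s 1) + Var 0 * s 2) * s 4 + s 3 * s 5)"

text \<open>Entries of the matrix of linear forms, then the cofactors of its minors. Syzygies reduce
  the cofactor of the second quadric modulo the first, and that of the third minor modulo
  \<open>x\<^sub>0\<close> and the form led by \<open>Var i\<close>, leaving a binary form with
  \<open>u + 3\<close> coefficients.\<close>

definition cubic_slots :: "nat \<Rightarrow> nat \<Rightarrow> nat \<Rightarrow> nat \<Rightarrow> (nat \<Rightarrow>\<^sub>0 nat) set list" where
  "cubic_slots u i j v = (let \<mu> = Poly_Mapping.single i 1 + Poly_Mapping.single j 1 in
     [lower {1..3} i, lower {1..3} j, lower ({1..3} - {j}) v, hmons {..3} 1, hmons {..3} 1,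
      hmons {..3} (u + 2), nondiv {..3} (u + 2) \<mu>, hmons ({1..3} - {i}) (u + 2)])"

definition cubic_family :: "nat \<Rightarrow> nat \<Rightarrow> nat \<Rightarrow> nat \<Rightarrow> (nat \<times> (nat \<Rightarrow>\<^sub>0 nat) \<Rightarrow> complex) \<Rightarrow> mpoly" where
  "cubic_family u i j v x = (let s = (\<lambda>k. slot k (cubic_slots u i j v ! k) x) in
     ((Var i + s 0) * (Var j + s 1) + Var 0 * s 3) * s 5 + ((Var i + s 0) * (Var v + s 2) + Var 0 * s 4) * s 6
     + ((Var j + s 1) * s 4 - (Var v + s 2) * s 3) * s 7)"

lemma finite_nondiv [simp]: "finite W \<Longrightarrow> finite (nondiv W k \<mu>)"
  by (simp add: nondiv_def)

lemma finite_slots: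
  "M \<in> set (conic_slots u i \<kappa>) \<Longrightarrow> finite M"
  "M \<in> set (quartic_slots u i j) \<Longrightarrow> finite M"
  "M \<in> set (cubic_slots u i j v) \<Longrightarrow> finite M"
  by (auto simp: conic_slots_def quartic_slots_def cubic_slots_def Let_def)

lemma length_slots:
  "length (conic_slots u i \<kappa>) = 4" "length (quartic_slots u i j) = 6" "length (cubic_slots u i j v) = 8"
  by (simp_all add: conic_slots_def quartic_slots_def cubic_slots_def Let_def)

lemma poly_family_conic:
  "finite (slots_index (conic_slots u i \<kappa>)) \<and> poly_family (slots_index (conic_slots u i \<kappa>)) (conic_family u i \<kappa>)"
proof
  let ?I = "slots_index (conic_slots u i \<kappa>)"
  show fin: "finite ?I" by (rule finite_slots_index) (erule finite_slots)
  have sl: "poly_family ?I (slot k (conic_slots u i \<kappa> ! k))" if "k < 4" for k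
    by (rule poly_family_slots) (use that in \<open>auto simp: length_slots intro: finite_slots\<close>)
  show "poly_family ?I (conic_family u i \<kappa>)"
    unfolding conic_family_def[abs_def] Let_def
    by (intro poly_family_add[OF fin] poly_family_mult[OF fin] poly_family_diff[OF fin]
        poly_family_const[OF fin] sl) simp_all
qed

lemma poly_family_quartic:
  "finite (slots_index (quartic_slots u i j)) \<and> poly_family (slots_index (quartic_slots u i j)) (quartic_family u i j)"
proof
  let ?I = "slots_index (quartic_slots u i j)"
  show fin: "finite ?I" by (rule finite_slots_index) (erule finite_slots)
  have sl: "poly_family ?I (slot k (quartic_slots u i j ! k))" if "k < 6" for k
    by (rule poly_family_slots) (use that in \<open>auto simp: length_slots intro: finite_slots\<close>)
  show "poly_family ?I (quartic_family u i j)"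
    unfolding quartic_family_def[abs_def] Let_def
    by (intro poly_family_add[OF fin] poly_family_mult[OF fin] poly_family_diff[OF fin]
        poly_family_const[OF fin] sl) simp_all
qed

lemma poly_family_cubic:
  "finite (slots_index (cubic_slots u i j v)) \<and> poly_family (slots_index (cubic_slots u i j v)) (cubic_family u i j v)"
proof
  let ?I = "slots_index (cubic_slots u i j v)"
  show fin: "finite ?I" by (rule finite_slots_index) (erule finite_slots)
  have sl: "poly_family ?I (slot k (cubic_slots u i j v ! k))" if "k < 8" for k
    by (rule poly_family_slots) (use that in \<open>auto simp: length_slots intro: finite_slots\<close>)
  show "poly_family ?I (cubic_family u i j v)"
    unfolding cubic_family_def[abs_def] Let_def
    by (intro poly_family_add[OF fin] poly_family_mult[OF fin] poly_family_diff[OF fin]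
        poly_family_const[OF fin] sl) simp_all
qed

lemma choose_3_Suc: "Suc n choose 3 = (n choose 3) + (n choose 2)"
  by (simp add: numeral_3_eq_3 numeral_2_eq_2)

lemma choose_2_Suc: "Suc n choose 2 = (n choose 2) + n"
  by (simp add: numeral_2_eq_2)

text \<open>All binomials are written over the same two, which turns the comparisons below into
  linear arithmetic.\<close>

lemma choose_expand:
  fixes u :: nat
  shows "u + 4 choose 2 = (u + 3 choose 2) + u + 3" "u + 5 choose 2 = (u + 3 choose 2) + 2 * u + 7"
    "u + 6 choose 2 = (u + 3 choose 2) + 3 * u + 12"
    "u + 4 choose 3 = (u + 3 choose 3) + (u + 3 choose 2)"
    "u + 5 choose 3 = (u + 3 choose 3) + 2 * (u + 3 choose 2) + u + 3"
    "u + 6 choose 3 = (u + 3 choose 3) + 3 * (u + 3 choose 2) + 3 * u + 10"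
    "u + 7 choose 3 = (u + 3 choose 3) + 4 * (u + 3 choose 2) + 6 * u + 22"
proof -
  have n: "u + 4 = Suc (u + 3)" "u + 5 = Suc (u + 4)" "u + 6 = Suc (u + 5)" "u + 7 = Suc (u + 6)" by simp_all
  show a: "u + 4 choose 2 = (u + 3 choose 2) + u + 3" by (simp only: n(1) choose_2_Suc)
  then show b: "u + 5 choose 2 = (u + 3 choose 2) + 2 * u + 7" by (simp only: n(2) choose_2_Suc)
  then show c: "u + 6 choose 2 = (u + 3 choose 2) + 3 * u + 12" by (simp only: n(3) choose_2_Suc)
  show d: "u + 4 choose 3 = (u + 3 choose 3) + (u + 3 choose 2)" by (simp only: n(1) choose_3_Suc)
  with a show e: "u + 5 choose 3 = (u + 3 choose 3) + 2 * (u + 3 choose 2) + u + 3"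
    by (simp only: n(2) choose_3_Suc)
  with b show f: "u + 6 choose 3 = (u + 3 choose 3) + 3 * (u + 3 choose 2) + 3 * u + 10"
    by (simp only: n(3) choose_3_Suc)
  with c show "u + 7 choose 3 = (u + 3 choose 3) + 4 * (u + 3 choose 2) + 6 * u + 22"
    by (simp only: n(4) choose_3_Suc)
qed

section \<open>Comparing numbers of parameters with the number of forms\<close>

lemma card_hmons_3: "card (hmons {..3} k) = k + 3 choose 3"
  by (rule card_hmons) simp_all

lemma card_hmons_2: "i \<in> {..3} \<Longrightarrow> card (hmons ({..3} - {i}) k) = k + 2 choose 2"
  by (rule card_hmons) simp_all

lemma card_hmons_1: "i \<in> {1..3} \<Longrightarrow> card (hmons ({1..3} - {i}) k) = k + 1"
  using card_hmons[of "{1..3} - {i}" 1 k] by simp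

text \<open>A conic has 8 parameters and imposes \<open>2 (u + 4) + 1\<close> conditions in degree
  \<open>u + 4\<close>. The summand 2 here and in the next two counts pays for the two monomials
  missing from the ideal that contains \<open>A\<close>.\<close>

lemma card_conic_slots:
  assumes "u \<ge> 1" "i \<in> {..3}" "\<kappa> \<in> hmons ({..3} - {i}) 2"
  shows "card (slots_index (conic_slots u i \<kappa>)) + 2 < u + 7 choose 3"
proof -
  have "{v \<in> {..3}. v < i} = {..<i}" using assms(2) by auto
  then have "card (lower {..3} i) \<le> 3" using card_lower[of "{..3}" i] assms(2) by simp
  moreover have "card (hmons ({..3} - {i}) 2 - {\<kappa>}) = 5"
    using assms(2,3) by (simp add: card_hmons_2 choose_two)
  moreover have "card (hmons {..3} (u + 3)) = u + 6 choose 3"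
    using card_hmons_3[of "u + 3"] by (simp only: add.assoc arith_simps)
  moreover have "card (hmons ({..3} - {i}) (u + 2)) = u + 4 choose 2"
    using card_hmons_2[OF assms(2), of "u + 2"] by (simp only: add.assoc arith_simps)
  moreover have "card (slots_index (conic_slots u i \<kappa>)) = sum_list (map card (conic_slots u i \<kappa>))"
    by (rule card_slots_index) (erule finite_slots)
  ultimately show ?thesis
    unfolding conic_slots_def Let_def list.map sum_list.Cons sum_list.Nil choose_expand
    using assms(1) by linarith
qed

lemma card_lower_plane: "i \<in> {1..3} \<Longrightarrow> card (lower {1..3} i) \<le> i - 1"
proof -
  assume i: "i \<in> {1..3}"
  have "{v \<in> {1..3}. v < i} = {1..<i}" using i by auto
  then show ?thesis using card_lower[of "{1..3}" i] by simp
qed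

lemma single_add_in_hmons:
  assumes "i \<in> W" "j \<in> W"
  shows "Poly_Mapping.single i 1 + Poly_Mapping.single j 1 \<in> hmons W 2"
  using hmons_add[OF hmons_single[OF assms(1), of 1] hmons_single[OF assms(2), of 1]] by (simp only: one_add_one)

lemma card_nondiv_quadric:
  assumes "i \<in> {1..3}" "j \<in> {1..3}"
  shows "card (nondiv {..3} (u + 2) (Poly_Mapping.single i 1 + Poly_Mapping.single j 1)) + (u + 3 choose 3)
    = u + 5 choose 3"
proof -
  have "Poly_Mapping.single i 1 + Poly_Mapping.single j 1 \<in> hmons {..3} 2"
    using assms by (intro single_add_in_hmons) auto
  from card_nondiv[OF _ this, of u] show ?thesis
    using card_hmons_3[of u] card_hmons_3[of "u + 2"] by (simp only: add.assoc arith_simps finite_atMost simp_thms)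
qed

text \<open>At most 17 parameters for the pair of quadrics, against \<open>4 (u + 4)\<close>
  conditions.\<close>

lemma card_quartic_slots:
  assumes "u \<ge> 1" "i \<in> {1..3}" "j \<in> {1..3}"
  shows "card (slots_index (quartic_slots u i j)) + 2 < u + 7 choose 3"
proof -
  let ?\<mu> = "Poly_Mapping.single i 1 + Poly_Mapping.single j 1 :: nat \<Rightarrow>\<^sub>0 nat"
  have "card (lower {1..3} i) \<le> 2" "card (lower {1..3} j) \<le> 2"
    using card_lower_plane[of i] card_lower_plane[of j] assms by auto
  moreover have "card (hmons {..3} 1) = 4" using card_hmons_3[of 1] by (simp add: eval_nat_numeral)
  moreover have "card (hmons {..3} 2 - {?\<mu>}) = 9"
  proof -
    have "?\<mu> \<in> hmons {..3} 2" using assms by (intro single_add_in_hmons) auto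
    moreover have "card (hmons {..3} 2) = 10" using card_hmons_3[of 2] by (simp add: eval_nat_numeral)
    ultimately show ?thesis by simp
  qed
  moreover have "card (hmons {..3} (u + 2)) = u + 5 choose 3"
    using card_hmons_3[of "u + 2"] by (simp only: add.assoc arith_simps)
  moreover note card_nondiv_quadric[OF assms(2,3), of u]
  moreover have "card (slots_index (quartic_slots u i j)) = sum_list (map card (quartic_slots u i j))"
    by (rule card_slots_index) (erule finite_slots)
  ultimately show ?thesis
    unfolding quartic_slots_def Let_def list.map sum_list.Cons sum_list.Nil choose_expand
    using assms(1) by linarith
qed

text \<open>At most 13 parameters for the matrix, against \<open>3 (u + 4) + 1\<close>
  conditions.\<close>

lemma card_cubic_slots:
  assumes "u \<ge> 1" "i \<in> {1..3}" "j \<in> {1..3}" "v \<in> {1..3} - {j}"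
  shows "card (slots_index (cubic_slots u i j v)) + 2 < u + 7 choose 3"
proof -
  let ?\<mu> = "Poly_Mapping.single i 1 + Poly_Mapping.single j 1 :: nat \<Rightarrow>\<^sub>0 nat"
  have "card (lower {1..3} i) \<le> 2" using card_lower_plane[of i] assms by auto
  moreover have "card (lower {1..3} j) + card (lower ({1..3} - {j}) v) \<le> 3"
  proof -
    have "{w \<in> {1..3} - {j}. w < v} = {1..<v} - {j}" using assms by auto
    then have "card (lower ({1..3} - {j}) v) \<le> card ({1..<v} - {j})"
      using card_lower[of "{1..3} - {j}" v] by simp
    also have "\<dots> = (if j < v then v - 2 else v - 1)" using assms by auto
    finally show ?thesis using card_lower_plane[OF assms(3)] assms by (auto split: if_splits)
  qed
  moreover have "card (hmons {..3} 1) = 4" using card_hmons_3[of 1] by (simp add: eval_nat_numeral)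
  moreover have "card (hmons {..3} (u + 2)) = u + 5 choose 3"
    using card_hmons_3[of "u + 2"] by (simp only: add.assoc arith_simps)
  moreover note card_nondiv_quadric[OF assms(2,3), of u]
  moreover have "card (hmons ({1..3} - {i}) (u + 2)) = u + 3"
    using card_hmons_1[OF assms(2), of "u + 2"] by simp
  moreover have "card (slots_index (cubic_slots u i j v)) = sum_list (map card (cubic_slots u i j v))"
    by (rule card_slots_index) (erule finite_slots)
  ultimately show ?thesis
    unfolding cubic_slots_def Let_def list.map sum_list.Cons sum_list.Nil choose_expand
    using assms(1) by linarith
qed

section \<open>Reduction of the three shapes to their normal forms\<close>

lemma single_one_inj: "Poly_Mapping.single i (1::nat) = Poly_Mapping.single j 1 \<longleftrightarrow> i = j"
proof
  assume "Poly_Mapping.single i (1::nat) = Poly_Mapping.single j 1"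
  then have "Poly_Mapping.keys (Poly_Mapping.single i (1::nat)) = Poly_Mapping.keys (Poly_Mapping.single j (1::nat))"
    by (simp only:)
  then show "i = j" by simp
qed simp

lemma part_combination:
  assumes "Poly_Mapping.keys (f * p + g * q) \<subseteq> hmons W k" "k = a + i" "k = b + j"
    "Poly_Mapping.keys p \<subseteq> hmons W i" "Poly_Mapping.keys q \<subseteq> hmons W j"
  shows "f * p + g * q = part (hmons W a) f * p + part (hmons W b) g * q"
proof -
  have "f * p + g * q = part (hmons W k) (f * p) + part (hmons W k) (g * q)"
    using part_ident[OF assms(1)] by (simp only: part_add)
  also have "part (hmons W k) (f * p) = part (hmons W a) f * p"
    unfolding assms(2) by (rule part_mult[OF assms(4)])
  also have "part (hmons W k) (g * q) = part (hmons W b) g * q"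
    unfolding assms(3) by (rule part_mult[OF assms(5)])
  finally show ?thesis .
qed

lemma on_conic_normal_form:
  assumes A: "on_conic A" "Poly_Mapping.keys A \<subseteq> hmons {..3} (u + 4)"
  shows "\<exists>i\<in>{..3}. \<exists>\<kappa>\<in>hmons ({..3} - {i}) 2. \<exists>x. A = conic_family u i \<kappa> x"
proof -
  from A(1) obtain n q g h where n: "Poly_Mapping.keys n \<subseteq> hmons {..3} 1" "n \<noteq> 0"
    and q: "Poly_Mapping.keys q \<subseteq> hmons {..3} 2" and A_eq: "A = n * g + q * h"
    unfolding on_conic_def by (elim exE conjE)
  obtain i c r where i: "i \<in> {..3}" and n_eq: "n = Const c * (Var i + r)"
    and r: "Poly_Mapping.keys r \<subseteq> lower {..3} i"
    using n by (rule linear_form_monic[OF finite_atMost])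
  define L where "L = Var i + r"
  have L: "Poly_Mapping.keys L \<subseteq> hmons {..3} 1"
    unfolding L_def by (rule keys_Var_plus_lower[OF i r])
  have A1: "A = Const c * g * L + h * q" by (simp add: A_eq n_eq L_def mult_ac)
  define g1 where "g1 = part (hmons {..3} (u + 3)) (Const c * g)"
  define h1 where "h1 = part (hmons {..3} (u + 2)) h"
  have A2: "A = g1 * L + h1 * q"
    using A(2) unfolding A1 g1_def h1_def by (rule part_combination[OF _ _ _ L q]) simp_all
  have g1: "Poly_Mapping.keys g1 \<subseteq> hmons {..3} (u + 3)" unfolding g1_def by (rule keys_part)
  have h1: "Poly_Mapping.keys h1 \<subseteq> hmons {..3} (u + 2)" unfolding h1_def by (rule keys_part)
  obtain s q1 where s: "q = s * (Var i + r) + q1" "Poly_Mapping.keys s \<subseteq> hmons {..3} 1"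
    "Poly_Mapping.keys q1 \<subseteq> hmons ({..3} - {i}) (Suc 1)"
    using division_by_monic_linear[OF q[folded Suc_1] i r] .
  obtain s' h2 where s': "h1 = s' * (Var i + r) + h2" "Poly_Mapping.keys s' \<subseteq> hmons {..3} (u + 1)"
    "Poly_Mapping.keys h2 \<subseteq> hmons ({..3} - {i}) (Suc (u + 1))"
    using division_by_monic_linear[OF _ i r, of h1 "u + 1"] h1 by auto
  \<comment> \<open>The multiples of the plane equation split off from \<open>q\<close> and
    \<open>h1\<close> are absorbed into its cofactor.\<close>
  define G where "G = g1 + s * h1 + s' * q1"
  have A3: "A = L * G + q1 * h2"
    by (simp add: A2 s(1) s'(1) G_def L_def algebra_simps)
  have q1': "Poly_Mapping.keys q1 \<subseteq> hmons {..3} 2"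
    using s(3) hmons_mono[of "{..3} - {i}" "{..3}" "Suc 1"] unfolding Suc_1 by blast
  have G: "Poly_Mapping.keys G \<subseteq> hmons {..3} (u + 3)"
  proof -
    have "Poly_Mapping.keys (s * h1) \<subseteq> hmons {..3} (1 + (u + 2))" by (rule keys_mult_hmons[OF s(2) h1])
    moreover have "Poly_Mapping.keys (s' * q1) \<subseteq> hmons {..3} (u + 1 + 2)" by (rule keys_mult_hmons[OF s'(2) q1'])
    moreover have "1 + (u + 2) = u + 3" "u + 1 + 2 = u + 3" by simp_all
    ultimately show ?thesis unfolding G_def by (intro keys_plus_subset g1) (simp_all only:)
  qed
  have "\<exists>\<kappa>\<in>hmons ({..3} - {i}) 2. \<exists>q2 h3. Poly_Mapping.keys q2 \<subseteq> hmons ({..3} - {i}) 2 - {\<kappa>} \<and>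
    Poly_Mapping.keys h3 \<subseteq> hmons ({..3} - {i}) (u + 2) \<and> q1 * h2 = (Poly_Mapping.single \<kappa> 1 + q2) * h3"
  proof (cases "q1 = 0")
    case True
    \<comment> \<open>The conic equation may vanish on the plane. Then any monic conic will do, here
      \<open>x\<^sub>j\<^sup>2\<close>, with cofactor 0.\<close>
    define j where "j = (if i = 0 then 1 else 0 :: nat)"
    have "j \<in> {..3} - {i}" by (simp add: j_def)
    then have "Poly_Mapping.single j 2 \<in> hmons ({..3} - {i}) 2" by (rule hmons_single)
    then show ?thesis by (rule bexI[rotated]) (use True in \<open>intro exI[of _ 0], simp\<close>)
  next
    case False
    then obtain \<kappa> where \<kappa>: "\<kappa> \<in> Poly_Mapping.keys q1" by fastforce
    define a where "a = Poly_Mapping.lookup q1 \<kappa>"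
    have a: "a \<noteq> 0" using \<kappa> by (simp add: a_def in_keys_iff)
    define q2 where "q2 = Const (inverse a) * q1 - Poly_Mapping.single \<kappa> 1"
    have \<kappa>2: "\<kappa> \<in> hmons ({..3} - {i}) 2" using \<kappa> s(3) unfolding Suc_1 by blast
    show ?thesis
    proof (intro bexI[OF _ \<kappa>2] exI conjI)
      have "Poly_Mapping.lookup q2 \<kappa> = 0" using a by (simp add: q2_def lookup_minus flip: a_def)
      moreover have "Poly_Mapping.keys q2 \<subseteq> hmons ({..3} - {i}) 2"
        unfolding q2_def using s(3) \<kappa>2 unfolding Suc_1
        by (intro keys_minus_subset keys_Const_times_subset) simp_all
      ultimately show "Poly_Mapping.keys q2 \<subseteq> hmons ({..3} - {i}) 2 - {\<kappa>}" by (auto simp: in_keys_iff)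
      show "Poly_Mapping.keys (Const a * h2) \<subseteq> hmons ({..3} - {i}) (u + 2)"
        using s'(3) by (intro keys_Const_times_subset) simp
      have "(Poly_Mapping.single \<kappa> 1 + q2) * (Const a * h2) = Const a * Const (inverse a) * (q1 * h2)"
        by (simp add: q2_def mult_ac)
      then show "q1 * h2 = (Poly_Mapping.single \<kappa> 1 + q2) * (Const a * h2)"
        unfolding Const_inverse[OF a] by (simp only: mult_1)
    qed
  qed
  then obtain \<kappa> q2 h3 where \<kappa>: "\<kappa> \<in> hmons ({..3} - {i}) 2"
    "Poly_Mapping.keys q2 \<subseteq> hmons ({..3} - {i}) 2 - {\<kappa>}" "Poly_Mapping.keys h3 \<subseteq> hmons ({..3} - {i}) (u + 2)"
    "q1 * h2 = (Poly_Mapping.single \<kappa> 1 + q2) * h3" by (elim bexE exE conjE)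
  have "list_all2 (\<lambda>f M. finite M \<and> Poly_Mapping.keys f \<subseteq> M) [r, q2, G, h3] (conic_slots u i \<kappa>)"
    unfolding conic_slots_def using r \<kappa> G by simp
  from slots_represent[OF this] obtain x where x: "\<forall>j<length (conic_slots u i \<kappa>).
      slot j (conic_slots u i \<kappa> ! j) x = [r, q2, G, h3] ! j"
    by (elim exE)
  have "A = conic_family u i \<kappa> x"
    unfolding conic_family_def Let_def A3 \<kappa>(4) L_def by (simp add: x length_slots)
  with i \<kappa>(1) show ?thesis by (intro bexI exI)
qed

lemma on_quartic_normal_form:
  assumes A: "on_quartic A" "Poly_Mapping.keys A \<subseteq> hmons {..3} (u + 4)"
  shows "\<exists>i\<in>{1..3}. \<exists>j\<in>{1..3}. \<exists>x. A = quartic_family u i j x"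
proof -
  from A(1) obtain l m n q g g' where l: "Poly_Mapping.keys l \<subseteq> hmons {1..3} 1" "l \<noteq> 0"
    and m: "Poly_Mapping.keys m \<subseteq> hmons {1..3} 1" "m \<noteq> 0" and n: "Poly_Mapping.keys n \<subseteq> hmons {..3} 1"
    and q: "Poly_Mapping.keys q \<subseteq> hmons {..3} 2" and A_eq: "A = (l * m + Var 0 * n) * g + q * g'"
    unfolding on_quartic_def by (elim exE conjE)
  obtain i c r where i: "i \<in> {1..3}" and c: "c \<noteq> 0" and l_eq: "l = Const c * (Var i + r)"
    and r: "Poly_Mapping.keys r \<subseteq> lower {1..3} i"
    using l by (rule linear_form_monic[OF finite_atLeastAtMost])
  obtain j b r' where j: "j \<in> {1..3}" and b: "b \<noteq> 0" and m_eq: "m = Const b * (Var j + r')"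
    and r': "Poly_Mapping.keys r' \<subseteq> lower {1..3} j"
    using m by (rule linear_form_monic[OF finite_atLeastAtMost])
  \<comment> \<open>Making \<open>l\<close> and \<open>m\<close> monic takes the constant
    \<open>c * b\<close> out of the quadric, so \<open>n\<close> is rescaled; the constant moves
    into the cofactor.\<close>
  define N where "N = Const (inverse (c * b)) * n"
  have N: "Poly_Mapping.keys N \<subseteq> hmons {..3} 1"
    unfolding N_def by (rule keys_Const_times_subset[OF n])
  have "c * b \<noteq> 0" using c b by simp
  from Const_inverse[OF this] have n_eq: "n = Const (c * b) * N"
    by (simp add: N_def mult.assoc[symmetric])
  define p where "p = (Var i + r) * (Var j + r') + Var 0 * N"
  have up: "hmons {1..3} 1 \<subseteq> hmons {..3} 1" by (rule hmons_mono) auto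
  have p: "Poly_Mapping.keys p \<subseteq> hmons {..3} 2"
    unfolding p_def
    using order_trans[OF keys_Var_plus_lower[OF i r] up] order_trans[OF keys_Var_plus_lower[OF j r'] up]
    by (rule keys_plus_subset[OF keys_mult_linear keys_mult_linear[OF keys_Var_hmons N]]) simp
  have A1: "A = Const (c * b) * g * p + g' * q"
    by (simp add: A_eq l_eq m_eq n_eq p_def Const_mult algebra_simps)
  define g1 where "g1 = part (hmons {..3} (u + 2)) (Const (c * b) * g)"
  define h1 where "h1 = part (hmons {..3} (u + 2)) g'"
  have A2: "A = g1 * p + h1 * q"
    using A(2) unfolding A1 g1_def h1_def by (rule part_combination[OF _ _ _ p q]) simp_all
  have g1: "Poly_Mapping.keys g1 \<subseteq> hmons {..3} (u + 2)" unfolding g1_def by (rule keys_part)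
  have h1: "Poly_Mapping.keys h1 \<subseteq> hmons {..3} (u + 2)" unfolding h1_def by (rule keys_part)
  let ?\<mu> = "Poly_Mapping.single i 1 + Poly_Mapping.single j 1"
  obtain s q1 where s: "q = s * p + q1" "Poly_Mapping.keys s \<subseteq> hmons {..3} 0"
    "Poly_Mapping.keys q1 \<subseteq> nondiv {..3} (0 + 2) ?\<mu>"
    using division_by_quadric_with_reducible_trace[OF _ i j r r' N, of q 0] q
    unfolding p_def add_0 by blast
  obtain s' h2 where s': "h1 = s' * p + h2" "Poly_Mapping.keys s' \<subseteq> hmons {..3} u"
    "Poly_Mapping.keys h2 \<subseteq> nondiv {..3} (u + 2) ?\<mu>"
    using division_by_quadric_with_reducible_trace[OF h1 i j r r' N] unfolding p_def by blast
  \<comment> \<open>In degree 2 the only multiple of \<open>\<mu>\<close> is \<open>\<mu>\<close>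
    itself, so reduction saves exactly one coefficient.\<close>
  have q1: "Poly_Mapping.keys q1 \<subseteq> hmons {..3} 2 - {?\<mu>}"
  proof
    fix m assume "m \<in> Poly_Mapping.keys q1"
    then have "m \<in> nondiv {..3} 2 ?\<mu>" using s(3)[unfolded add_0] by (rule subsetD[rotated])
    then have "m \<in> hmons {..3} 2" "m \<noteq> ?\<mu> + 0" unfolding nondiv_def by blast+
    then show "m \<in> hmons {..3} 2 - {?\<mu>}" by simp
  qed
  define G where "G = g1 + s * h1 + s' * q1"
  have A3: "A = p * G + q1 * h2"
    by (simp add: A2 s(1) s'(1) G_def algebra_simps)
  have G: "Poly_Mapping.keys G \<subseteq> hmons {..3} (u + 2)"
  proof -
    have "Poly_Mapping.keys (s * h1) \<subseteq> hmons {..3} (0 + (u + 2))" by (rule keys_mult_hmons[OF s(2) h1])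
    moreover have "Poly_Mapping.keys (s' * q1) \<subseteq> hmons {..3} (u + 2)"
      by (rule keys_mult_hmons[OF s'(2)]) (use q1 in blast)
    ultimately show ?thesis unfolding G_def add_0 by (intro keys_plus_subset g1)
  qed
  have "list_all2 (\<lambda>f M. finite M \<and> Poly_Mapping.keys f \<subseteq> M) [r, r', N, q1, G, h2] (quartic_slots u i j)"
    unfolding quartic_slots_def Let_def list_all2_Cons
    using r r' N q1 G s'(3) by (intro conjI) simp_all
  from slots_represent[OF this] obtain x where x: "\<forall>k<length (quartic_slots u i j).
      slot k (quartic_slots u i j ! k) x = [r, r', N, q1, G, h2] ! k"
    by (elim exE)
  have "A = quartic_family u i j x"
    unfolding quartic_family_def Let_def A3 p_def by (simp add: x length_slots)
  with i j show ?thesis by (intro bexI exI)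
qed

lemma on_cubic_normal_form:
  assumes A: "on_cubic A" "Poly_Mapping.keys A \<subseteq> hmons {..3} (u + 4)"
  shows "\<exists>i\<in>{1..3}. \<exists>j\<in>{1..3}. \<exists>v\<in>{1..3} - {j}. \<exists>x. A = cubic_family u i j v x"
proof -
  from A(1) obtain l m m' n n' g g' h where l: "Poly_Mapping.keys l \<subseteq> hmons {1..3} 1" "l \<noteq> 0"
    and m: "Poly_Mapping.keys m \<subseteq> hmons {1..3} 1" "m \<noteq> 0"
    and m': "Poly_Mapping.keys m' \<subseteq> hmons {1..3} 1" "\<not> m dvd m'"
    and n: "Poly_Mapping.keys n \<subseteq> hmons {..3} 1" and n': "Poly_Mapping.keys n' \<subseteq> hmons {..3} 1"
    and A_eq: "A = (l * m + Var 0 * n) * g + (l * m' + Var 0 * n') * g' + (m * n' - m' * n) * h"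
    unfolding on_cubic_def by (elim exE conjE)
  obtain i c r where i: "i \<in> {1..3}" and c: "c \<noteq> 0" and l_eq: "l = Const c * (Var i + r)"
    and r: "Poly_Mapping.keys r \<subseteq> lower {1..3} i"
    using l by (rule linear_form_monic[OF finite_atLeastAtMost])
  obtain j b r' where j: "j \<in> {1..3}" and b: "b \<noteq> 0" and m_eq: "m = Const b * (Var j + r')"
    and r': "Poly_Mapping.keys r' \<subseteq> lower {1..3} j"
    using m by (rule linear_form_monic[OF finite_atLeastAtMost])
  define L where "L = Var i + r"
  define M where "M = Var j + r'"
  have L1: "Poly_Mapping.keys L \<subseteq> hmons {1..3} 1"
    unfolding L_def by (rule keys_Var_plus_lower[OF i r])
  have M1: "Poly_Mapping.keys M \<subseteq> hmons {1..3} 1"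
    unfolding M_def by (rule keys_Var_plus_lower[OF j r'])
  define a where "a = Poly_Mapping.lookup m' (Poly_Mapping.single j 1)"
  \<comment> \<open>A column operation on the matrix: subtracting a multiple of \<open>M\<close>
    removes \<open>Var j\<close> from \<open>m'\<close>. The rest is nonzero because
    \<open>m\<close> does not divide \<open>m'\<close>.\<close>
  define m0 where "m0 = m' - Const a * M"
  have "Poly_Mapping.single j 1 \<notin> lower {1..3} j" unfolding lower_def by (auto simp only: single_one_inj image_iff mem_Collect_eq)
  then have "Poly_Mapping.lookup r' (Poly_Mapping.single j 1) = 0"
    using r' by (auto simp: in_keys_iff subset_eq)
  then have "Poly_Mapping.lookup m0 (Poly_Mapping.single j 1) = 0"
    by (simp add: m0_def M_def a_def lookup_minus lookup_add Var_def)
  moreover have "Poly_Mapping.keys m0 \<subseteq> hmons {1..3} 1"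
    unfolding m0_def by (intro keys_minus_subset keys_Const_times_subset m' M1)
  ultimately have m0: "Poly_Mapping.keys m0 \<subseteq> hmons ({1..3} - {j}) 1"
    unfolding hmons_1 by (auto simp only: in_keys_iff subset_eq image_iff Diff_iff)
  have "m0 \<noteq> 0"
  proof
    assume "m0 = 0"
    then have "m' = Const a * M" by (simp add: m0_def)
    also have "\<dots> = m * (Const (inverse b) * Const a)"
      using Const_inverse[OF b] by (simp add: m_eq M_def mult_ac)
    finally show False using m'(2) by simp
  qed
  obtain v a' t where v: "v \<in> {1..3} - {j}" and a': "a' \<noteq> 0" and m0_eq: "m0 = Const a' * (Var v + t)"
    and t: "Poly_Mapping.keys t \<subseteq> lower ({1..3} - {j}) v"
    using m0 \<open>m0 \<noteq> 0\<close> by (rule linear_form_monic[OF finite_Diff[OF finite_atLeastAtMost]])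
  define Q where "Q = Var v + t"
  have Q1: "Poly_Mapping.keys Q \<subseteq> hmons {1..3} 1"
    unfolding Q_def using keys_Var_plus_lower[OF v t] hmons_mono[of "{1..3} - {j}" "{1..3}" 1] by blast
  have m'_eq: "m' = Const a * M + Const a' * Q"
    using m0_eq by (simp add: m0_def Q_def algebra_simps)
  define N where "N = Const (inverse (c * b)) * n"
  have N: "Poly_Mapping.keys N \<subseteq> hmons {..3} 1"
    unfolding N_def by (rule keys_Const_times_subset[OF n])
  have "c * b \<noteq> 0" using c b by simp
  from Const_inverse[OF this] have n_eq: "n = Const c * Const b * N"
    by (simp add: N_def mult.assoc[symmetric] Const_mult[symmetric])
  \<comment> \<open>The same column operation and rescaling in the other row, so that the second
    quadric becomes a combination of \<open>p1\<close> and \<open>p2\<close>.\<close>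
  define N' where "N' = Const (inverse (c * a')) * (n' - Const (c * a) * N)"
  have N': "Poly_Mapping.keys N' \<subseteq> hmons {..3} 1"
    unfolding N'_def by (intro keys_Const_times_subset keys_minus_subset n' N)
  have "c * a' \<noteq> 0" using c a' by simp
  from Const_inverse[OF this] have "Const (c * a') * N' = n' - Const (c * a) * N"
    by (simp add: N'_def mult.assoc[symmetric])
  then have n'_eq: "n' = Const c * Const a * N + Const c * Const a' * N'"
    by (simp add: Const_mult algebra_simps)
  define p1 where "p1 = L * M + Var 0 * N"
  define p2 where "p2 = L * Q + Var 0 * N'"
  define D where "D = M * N' - Q * N"
  have up: "hmons {1..3} 1 \<subseteq> hmons {..3} 1" by (rule hmons_mono) auto
  note L3 = order_trans[OF L1 up] and M3 = order_trans[OF M1 up] and Q3 = order_trans[OF Q1 up]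
  have x0: "Poly_Mapping.keys (Var 0) \<subseteq> hmons {..3} 1" by (rule keys_Var_hmons) simp
  have p1: "Poly_Mapping.keys p1 \<subseteq> hmons {..3} 2"
    unfolding p1_def by (intro keys_plus_subset keys_mult_linear L3 M3 x0 N)
  have p2: "Poly_Mapping.keys p2 \<subseteq> hmons {..3} 2"
    unfolding p2_def by (intro keys_plus_subset keys_mult_linear L3 Q3 x0 N')
  have D: "Poly_Mapping.keys D \<subseteq> hmons {..3} 2"
    unfolding D_def by (intro keys_minus_subset keys_mult_linear M3 Q3 N N')
  have A1: "A = (Const (c * b) * g + Const (c * a) * g') * p1 + (Const (c * a') * g') * p2
      + (Const (b * c * a') * h) * D"
    unfolding A_eq l_eq[folded L_def] m_eq[folded M_def] m'_eq n_eq n'_eq p1_def p2_def D_def Const_mult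
    by (simp add: algebra_simps)
  let ?P = "part (hmons {..3} (u + 2))"
  obtain G1 G2 H where G: "Poly_Mapping.keys G1 \<subseteq> hmons {..3} (u + 2)" "Poly_Mapping.keys G2 \<subseteq> hmons {..3} (u + 2)"
    "Poly_Mapping.keys H \<subseteq> hmons {..3} (u + 2)" and A2: "A = G1 * p1 + G2 * p2 + H * D"
  proof
    have e: "u + 2 + 2 = u + 4" by simp
    have "A = part (hmons {..3} (u + 2 + 2)) A" unfolding e part_ident[OF A(2)] ..
    then show "A = ?P (Const (c * b) * g + Const (c * a) * g') * p1 + ?P (Const (c * a') * g') * p2
        + ?P (Const (b * c * a') * h) * D"
      unfolding A1 part_add[of "hmons {..3} (u + 2 + 2)"] part_mult[OF p1] part_mult[OF p2] part_mult[OF D] .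
  qed (rule keys_part)+
  \<comment> \<open>The syzygies \<open>Var 0 * D = M * p2 - Q * p1\<close> and
    \<open>L * D = N' * p1 - N * p2\<close> move the parts of \<open>H\<close> divisible by
    \<open>Var 0\<close> or \<open>L\<close> into the cofactors of \<open>p1\<close> and
    \<open>p2\<close>.\<close>
  from split_plane[of H "u + 1"] G(3) obtain H1 w where H1: "Poly_Mapping.keys H1 \<subseteq> hmons {1..3} (Suc (u + 1))"
    "Poly_Mapping.keys w \<subseteq> hmons {..3} (u + 1)" "H = H1 + Var 0 * w" by auto
  obtain y H2 where y: "H1 = y * L + H2" "Poly_Mapping.keys y \<subseteq> hmons {1..3} (u + 1)"
    "Poly_Mapping.keys H2 \<subseteq> hmons ({1..3} - {i}) (Suc (u + 1))"
    using division_by_monic_linear[OF H1(1) i r] unfolding L_def by blast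
  have y3: "Poly_Mapping.keys y \<subseteq> hmons {..3} (u + 1)"
    using y(2) hmons_mono[of "{1..3}" "{..3}" "u + 1"] by auto
  have mult1: "Poly_Mapping.keys (f * f') \<subseteq> hmons {..3} (u + 2)"
    if "Poly_Mapping.keys f \<subseteq> hmons {..3} (u + 1)" "Poly_Mapping.keys f' \<subseteq> hmons {..3} 1" for f f'
    using keys_mult_hmons[OF that] by (simp only: add.assoc one_add_one)
  define G3 where "G3 = G1 + y * N' - w * Q"
  define G4 where "G4 = G2 - y * N + w * M"
  have G3: "Poly_Mapping.keys G3 \<subseteq> hmons {..3} (u + 2)"
    unfolding G3_def by (intro keys_plus_subset keys_minus_subset G mult1 y3 H1 N' Q3)
  have G4: "Poly_Mapping.keys G4 \<subseteq> hmons {..3} (u + 2)"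
    unfolding G4_def by (intro keys_plus_subset keys_minus_subset G mult1 y3 H1 N M3)
  have A3: "A = G3 * p1 + G4 * p2 + H2 * D"
    unfolding A2 H1(3) y(1) G3_def G4_def p1_def p2_def D_def by (simp add: algebra_simps)
  let ?\<mu> = "Poly_Mapping.single i 1 + Poly_Mapping.single j 1"
  obtain s G5 where s: "G4 = s * p1 + G5" "Poly_Mapping.keys s \<subseteq> hmons {..3} u"
    "Poly_Mapping.keys G5 \<subseteq> nondiv {..3} (u + 2) ?\<mu>"
    using division_by_quadric_with_reducible_trace[OF G4 i j r r' N] unfolding p1_def L_def M_def by blast
  \<comment> \<open>The trivial syzygy between \<open>p1\<close> and \<open>p2\<close> moves the
    quotient \<open>s\<close> into the cofactor of \<open>p1\<close>.\<close>
  define G6 where "G6 = G3 + s * p2"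
  have G6: "Poly_Mapping.keys G6 \<subseteq> hmons {..3} (u + 2)"
    unfolding G6_def by (intro keys_plus_subset G3 keys_mult_hmons s p2)
  have A4: "A = p1 * G6 + p2 * G5 + D * H2"
    unfolding A3 s(1) G6_def by (simp add: algebra_simps)
  have H2: "Poly_Mapping.keys H2 \<subseteq> hmons ({1..3} - {i}) (u + 2)" using y(3) by simp
  have "list_all2 (\<lambda>f M. finite M \<and> Poly_Mapping.keys f \<subseteq> M) [r, r', t, N, N', G6, G5, H2] (cubic_slots u i j v)"
    unfolding cubic_slots_def Let_def list_all2_Cons
    using r r' t N N' G6 s(3) H2 by (intro conjI) simp_all
  from slots_represent[OF this] obtain x where x: "\<forall>k<length (cubic_slots u i j v).
      slot k (cubic_slots u i j v ! k) x = [r, r', t, N, N', G6, G5, H2] ! k"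
    by (elim exE)
  have "A = cubic_family u i j v x"
    unfolding cubic_family_def Let_def A4 p1_def p2_def D_def L_def M_def Q_def by (simp add: x length_slots)
  with i j v show ?thesis by (intro bexI exI)
qed

subsection \<open>The surface\<close>

lemma hmons_singleton: "hmons {w} k \<subseteq> {Poly_Mapping.single w k}"
proof (induction k)
  case 0
  show ?case by (simp add: hmons_0)
next
  case (Suc k)
  show ?case
  proof
    fix m assume "m \<in> hmons {w} (Suc k)"
    then obtain i m' where "i \<in> {w}" "m' \<in> hmons {w} k" "m = Poly_Mapping.single i 1 + m'"
      by (rule hmons_SucE)
    with Suc have "m = Poly_Mapping.single w 1 + Poly_Mapping.single w k" by auto
    then show "m \<in> {Poly_Mapping.single w (Suc k)}" by (simp flip: single_add)
  qed
qed

text \<open>The monomials of degree \<open>u + 4\<close> in the ideal generated by \<open>x\<^sub>0\<close>, \<open>x\<^sub>1\<close> and the square of \<open>x\<^sub>2\<close>.\<close>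

definition adapted_hmons :: "nat \<Rightarrow> (nat \<Rightarrow>\<^sub>0 nat) set" where
  "adapted_hmons u = hmons {..3} (u + 4) -
     {Poly_Mapping.single 3 (u + 4), Poly_Mapping.single 2 1 + Poly_Mapping.single 3 (u + 3)}"

lemma card_adapted_hmons: "u + 7 choose 3 \<le> card (adapted_hmons u) + 2"
proof -
  let ?B = "{Poly_Mapping.single 3 (u + 4), Poly_Mapping.single 2 1 + Poly_Mapping.single 3 (u + 3)} :: (nat \<Rightarrow>\<^sub>0 nat) set"
  have "card (hmons {..3} (u + 4)) - card ?B \<le> card (adapted_hmons u)"
    unfolding adapted_hmons_def by (rule diff_card_le_card_Diff) simp
  moreover have "card ?B \<le> 2" by (simp add: card_insert_if)
  moreover have "card (hmons {..3} (u + 4)) = u + 7 choose 3"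
    using card_hmons_3[of "u + 4"] by (simp only: add.assoc arith_simps)
  ultimately show ?thesis by linarith
qed

lemma adapted_decomposition:
  assumes A: "Poly_Mapping.keys A \<subseteq> adapted_hmons u"
  shows "\<exists>A0 A1 A2. Poly_Mapping.keys A0 \<subseteq> hmons {..3} (u + 3) \<and> Poly_Mapping.keys A1 \<subseteq> hmons {..3} (u + 3) \<and>
    Poly_Mapping.keys A2 \<subseteq> hmons {..3} (u + 2) \<and> A = Var 0 * A0 + Var 1 * A1 + Var 2 ^ 2 * A2"
proof (induction A rule: poly_mapping_monom_induct)
  case zero
  show ?case by (intro exI[of _ 0]) simp
next
  case (add f g)
  then obtain A0 A1 A2 B0 B1 B2 where
    "Poly_Mapping.keys A0 \<subseteq> hmons {..3} (u + 3)" "Poly_Mapping.keys A1 \<subseteq> hmons {..3} (u + 3)"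
    "Poly_Mapping.keys A2 \<subseteq> hmons {..3} (u + 2)" "f = Var 0 * A0 + Var 1 * A1 + Var 2 ^ 2 * A2"
    "Poly_Mapping.keys B0 \<subseteq> hmons {..3} (u + 3)" "Poly_Mapping.keys B1 \<subseteq> hmons {..3} (u + 3)"
    "Poly_Mapping.keys B2 \<subseteq> hmons {..3} (u + 2)" "g = Var 0 * B0 + Var 1 * B1 + Var 2 ^ 2 * B2"
    by (elim exE conjE)
  then show ?case
    by - (rule exI[of _ "A0 + B0"], rule exI[of _ "A1 + B1"], rule exI[of _ "A2 + B2"],
        simp add: keys_plus_subset algebra_simps)
next
  case (single m)
  define c where "c = Poly_Mapping.lookup A m"
  have m: "m \<in> hmons {..3} (Suc (u + 3))" "m \<noteq> Poly_Mapping.single 3 (u + 4)"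
    "m \<noteq> Poly_Mapping.single 2 1 + Poly_Mapping.single 3 (u + 3)"
    using single A by (auto simp: adapted_hmons_def eval_nat_numeral)
  consider "0 \<in> Poly_Mapping.keys m" | "1 \<in> Poly_Mapping.keys m"
    | "0 \<notin> Poly_Mapping.keys m" "1 \<notin> Poly_Mapping.keys m" by blast
  then show ?case unfolding c_def[symmetric]
  proof cases
    case 1
    with m(1) obtain m' where m': "m' \<in> hmons {..3} (u + 3)" "m = Poly_Mapping.single 0 1 + m'"
      by (rule hmons_minus_single)
    then show "\<exists>A0 A1 A2. Poly_Mapping.keys A0 \<subseteq> hmons {..3} (u + 3) \<and> Poly_Mapping.keys A1 \<subseteq> hmons {..3} (u + 3) \<and>
      Poly_Mapping.keys A2 \<subseteq> hmons {..3} (u + 2) \<and> Poly_Mapping.single m c = Var 0 * A0 + Var 1 * A1 + Var 2 ^ 2 * A2"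
      by - (rule exI[of _ "Poly_Mapping.single m' c"], rule exI[of _ 0], rule exI[of _ 0],
          simp add: Var_def mult_single)
  next
    case 2
    with m(1) obtain m' where m': "m' \<in> hmons {..3} (u + 3)" "m = Poly_Mapping.single 1 1 + m'"
      by (rule hmons_minus_single)
    then show "\<exists>A0 A1 A2. Poly_Mapping.keys A0 \<subseteq> hmons {..3} (u + 3) \<and> Poly_Mapping.keys A1 \<subseteq> hmons {..3} (u + 3) \<and>
      Poly_Mapping.keys A2 \<subseteq> hmons {..3} (u + 2) \<and> Poly_Mapping.single m c = Var 0 * A0 + Var 1 * A1 + Var 2 ^ 2 * A2"
      by - (rule exI[of _ 0], rule exI[of _ "Poly_Mapping.single m' c"], rule exI[of _ 0],
          simp add: Var_def mult_single)
  next
    case 3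
    have s: "n \<in> hmons {3} k" if "n \<in> hmons {..3} k" "0 \<notin> Poly_Mapping.keys n" "1 \<notin> Poly_Mapping.keys n"
      "2 \<notin> Poly_Mapping.keys n" for n k
    proof -
      have "v = 3" if "v \<in> Poly_Mapping.keys n" for v
      proof -
        have "v \<le> 3" using that \<open>n \<in> hmons {..3} k\<close> by (auto simp: hmons_def)
        moreover have "v \<noteq> 0" "v \<noteq> 1" "v \<noteq> 2"
          using that \<open>0 \<notin> Poly_Mapping.keys n\<close> \<open>1 \<notin> Poly_Mapping.keys n\<close> \<open>2 \<notin> Poly_Mapping.keys n\<close> by metis+
        ultimately show ?thesis by linarith
      qed
      with that show ?thesis by (auto simp: hmons_def)
    qed
    \<comment> \<open>Now \<open>m\<close> involves only \<open>Var 2\<close> and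
      \<open>Var 3\<close>, and the two excluded monomials are those of degree at most 1 in
      \<open>Var 2\<close>.\<close>
    have "2 \<in> Poly_Mapping.keys m"
    proof (rule ccontr)
      assume "2 \<notin> Poly_Mapping.keys m"
      from s[OF m(1) 3 this] hmons_singleton[of 3 "Suc (u + 3)"]
      have "m = Poly_Mapping.single 3 (Suc (u + 3))" by blast
      with m(2) show False by (simp add: eval_nat_numeral)
    qed
    with m(1) obtain m' where m': "m' \<in> hmons {..3} (u + 3)" "m = Poly_Mapping.single 2 1 + m'"
      by (rule hmons_minus_single)
    have k: "0 \<notin> Poly_Mapping.keys m'" "1 \<notin> Poly_Mapping.keys m'"
      using 3 unfolding m'(2) keys_add_nat by blast+
    have "2 \<in> Poly_Mapping.keys m'"
    proof (rule ccontr)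
      assume "2 \<notin> Poly_Mapping.keys m'"
      from s[OF m'(1) k this] hmons_singleton[of 3 "u + 3"] have "m' = Poly_Mapping.single 3 (u + 3)" by blast
      with m(3) m'(2) show False by simp
    qed
    moreover have "m' \<in> hmons {..3} (Suc (u + 2))" using m'(1) by (simp add: eval_nat_numeral)
    ultimately obtain m'' where m'': "m'' \<in> hmons {..3} (u + 2)" "m' = Poly_Mapping.single 2 1 + m''"
      using hmons_minus_single by blast
    have "Poly_Mapping.single m c = Var 2 ^ 2 * Poly_Mapping.single m'' c"
      by (simp add: m'(2) m''(2) Var_def power2_eq_square mult_single add.assoc)
    with m''(1) show "\<exists>A0 A1 A2. Poly_Mapping.keys A0 \<subseteq> hmons {..3} (u + 3) \<and> Poly_Mapping.keys A1 \<subseteq> hmons {..3} (u + 3) \<and>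
      Poly_Mapping.keys A2 \<subseteq> hmons {..3} (u + 2) \<and> Poly_Mapping.single m c = Var 0 * A0 + Var 1 * A1 + Var 2 ^ 2 * A2"
      by - (rule exI[of _ 0], rule exI[of _ 0], rule exI[of _ "Poly_Mapping.single m'' c"], simp)
  qed
qed

text \<open>The choices of leading monomials give finitely many charts, and one \<open>A\<close>
  avoids the images of all of them simultaneously.\<close>

lemma exists_surface_without_small_curves:
  assumes u: "u \<ge> 1"
  shows "\<exists>A. Poly_Mapping.keys A \<subseteq> adapted_hmons u \<and> \<not> on_conic A \<and> \<not> on_cubic A \<and> \<not> on_quartic A"
proof -
  define C1 where "C1 = (\<lambda>(i, \<kappa>). (slots_index (conic_slots u i \<kappa>), conic_family u i \<kappa>)) `
    (SIGMA i:{..3}. hmons ({..3} - {i}) 2)"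
  define C2 where "C2 = (\<lambda>(i, j, v). (slots_index (cubic_slots u i j v), cubic_family u i j v)) `
    ({1..3} \<times> (SIGMA j:{1..3}. {1..3} - {j}))"
  define C3 where "C3 = (\<lambda>(i, j). (slots_index (quartic_slots u i j), quartic_family u i j)) ` ({1..3} \<times> {1..3})"
  have V: "finite (adapted_hmons u)" by (simp add: adapted_hmons_def)
  have fin: "finite (C1 \<union> C2 \<union> C3)"
    by (auto simp: C1_def C2_def C3_def intro!: finite_imageI finite_SigmaI)
  have small: "n < card (adapted_hmons u)" if "n + 2 < u + 7 choose 3" for n
    using that card_adapted_hmons[of u] by linarith
  have fam: "finite (fst c) \<and> card (fst c) < card (adapted_hmons u) \<and> poly_family (fst c) (snd c)"
    if c: "c \<in> C1 \<union> C2 \<union> C3" for c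
  proof -
    from c consider "c \<in> C1" | "c \<in> C2" | "c \<in> C3" by blast
    then show ?thesis
    proof cases
      case 1
      then obtain i \<kappa> where *: "i \<in> {..3}" "\<kappa> \<in> hmons ({..3} - {i}) 2"
        and "c = (slots_index (conic_slots u i \<kappa>), conic_family u i \<kappa>)"
        unfolding C1_def by (elim imageE SigmaE) simp
      then show ?thesis using poly_family_conic small[OF card_conic_slots[OF u *]] by simp
    next
      case 2
      then obtain i j v where *: "i \<in> {1..3}" "j \<in> {1..3}" "v \<in> {1..3} - {j}"
        and "c = (slots_index (cubic_slots u i j v), cubic_family u i j v)"
        unfolding C2_def by (elim imageE SigmaE) simp
      then show ?thesis using poly_family_cubic small[OF card_cubic_slots[OF u *]] by simp
    next
      case 3
      then obtain i j where *: "i \<in> {1..3}" "j \<in> {1..3}"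
        and "c = (slots_index (quartic_slots u i j), quartic_family u i j)"
        unfolding C3_def by (elim imageE SigmaE) simp
      then show ?thesis using poly_family_quartic small[OF card_quartic_slots[OF u *]] by simp
    qed
  qed
  from exists_form_avoiding_families[OF V fin fam] obtain A where
    A: "Poly_Mapping.keys A \<subseteq> adapted_hmons u" and ne: "\<And>c x. c \<in> C1 \<union> C2 \<union> C3 \<Longrightarrow> A \<noteq> snd c x"
    by blast
  have A': "Poly_Mapping.keys A \<subseteq> hmons {..3} (u + 4)" using A by (auto simp: adapted_hmons_def)
  have "\<not> on_conic A"
  proof
    assume "on_conic A"
    from on_conic_normal_form[OF this A'] obtain i \<kappa> x where
      *: "i \<in> {..3}" "\<kappa> \<in> hmons ({..3} - {i}) 2" "A = conic_family u i \<kappa> x" by (elim bexE exE)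
    have "(slots_index (conic_slots u i \<kappa>), conic_family u i \<kappa>) \<in> C1 \<union> C2 \<union> C3"
      unfolding C1_def using *(1,2) by force
    from ne[OF this, of x] *(3) show False by simp
  qed
  moreover have "\<not> on_cubic A"
  proof
    assume "on_cubic A"
    from on_cubic_normal_form[OF this A'] obtain i j v x where
      *: "i \<in> {1..3}" "j \<in> {1..3}" "v \<in> {1..3} - {j}" "A = cubic_family u i j v x" by (elim bexE exE)
    have "(slots_index (cubic_slots u i j v), cubic_family u i j v) \<in> C1 \<union> C2 \<union> C3"
      unfolding C2_def using *(1-3) by force
    from ne[OF this, of x] *(4) show False by simp
  qed
  moreover have "\<not> on_quartic A"
  proof
    assume "on_quartic A"
    from on_quartic_normal_form[OF this A'] obtain i j x where
      *: "i \<in> {1..3}" "j \<in> {1..3}" "A = quartic_family u i j x" by (elim bexE exE)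
    have "(slots_index (quartic_slots u i j), quartic_family u i j) \<in> C1 \<union> C2 \<union> C3"
      unfolding C3_def using *(1,2) by force
    from ne[OF this, of x] *(3) show False by simp
  qed
  ultimately show ?thesis using A by blast
qed

theorem theorem6p7:
  fixes d :: nat
  assumes "d \<ge> 6"
  shows "\<exists>f. f \<noteq> 0 \<and> hom_poly 3 d f \<and>
           f \<in> zariski_closure (Fset [2,2] 3 d) - Fset [2,2] 3 d \<and>
           f \<in> Fset [1,4] 3 d"
proof -
  \<comment> \<open>The shift writes the degree \<open>d - 1\<close> of \<open>A\<close> and the
    degrees of all cofactors as sums, free of truncated subtraction.\<close>
  define u where "u = d - 5"
  have u: "u \<ge> 1" and d: "d = u + 5" using assms by (simp_all add: u_def)
  from exists_surface_without_small_curves[OF u] obtain A where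
    A: "Poly_Mapping.keys A \<subseteq> adapted_hmons u" and no: "\<not> on_conic A" "\<not> on_cubic A" "\<not> on_quartic A"
    by blast
  have A': "Poly_Mapping.keys A \<subseteq> hmons {..3} (u + 4)" using A by (auto simp: adapted_hmons_def)
  let ?f = "Var 0 * A"
  have notin: "?f \<notin> Fset [2,2] 3 d" using plane_times_in_Fset_2_2 no by blast
  have "?f \<noteq> 0" using notin zero_in_Fset[of d] by metis
  moreover have "hom_poly 3 d ?f"
  proof -
    have "Poly_Mapping.keys ?f \<subseteq> hmons {..3} (1 + (u + 4))"
      by (rule keys_mult_hmons[OF keys_Var_hmons A']) simp
    then show ?thesis unfolding hom_poly_hmons d by (simp add: add.commute)
  qed
  moreover have "?f \<in> zariski_closure (Fset [2,2] 3 d)"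
  proof -
    from adapted_decomposition[OF A] obtain A0 A1 A2 where
      *: "Poly_Mapping.keys A0 \<subseteq> hmons {..3} (u + 3)" "Poly_Mapping.keys A1 \<subseteq> hmons {..3} (u + 3)"
      "Poly_Mapping.keys A2 \<subseteq> hmons {..3} (u + 2)" "A = Var 0 * A0 + Var 1 * A1 + Var 2 ^ 2 * A2"
      by (elim exE conjE)
    have n: "u + 3 = Suc (u + 2)" "d = u + 2 + 3" by (simp_all add: d)
    show ?thesis unfolding *(4) n(2)
      by (rule plane_times_in_closure[OF *(1,2)[unfolded n(1)] *(3)])
  qed
  moreover have "?f \<in> Fset [1,4] 3 d"
  proof (rule plane_times_in_Fset_1_4)
    have "d - 1 = u + 4" by (simp add: d)
    then show "Poly_Mapping.keys A \<subseteq> hmons {..3} (d - 1)" using A' by (simp only:)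
  qed
  ultimately show ?thesis using notin by blast
qed

end
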